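(* Let $\mu$ be any probability distribution on $\mathbb{N}=\{0,1,2,\dots\}$, and let $n\ge 3$ be any integer such that $\mathbb{P}(\#T_\mu=n)>0$, where $T_\mu$ is a $\mu$-Bienaymé tree. Let $T_{\mu,n}$ be a $\mu$-Bienaymé tree conditioned to have size $n$. Then for all $s>0$, \[\mathbb{P}\big(\mathrm{Wd}(T_{\mu,n})\,\mathrm{Ht}(T_{\mu,n})>s\,n\log n\big)\le 230\,s^{-2/13}.\]
   Context: For a finite rooted tree $t$: the size $\#t$ is its number of vertices; the height $\mathrm{Ht}(t)$ is the maximum graph distance of a vertex of $t$ to the root; the width $\mathrm{Wd}(t)$ is the maximum over $h\ge 0$ of the number of vertices at distance exactly $h$ from the root. A plane tree is a finite rooted tree in which the children of every vertex are linearly ordered. A $\mu$-Bienaymé tree $T_\mu$ (also called Galton--Watson tree) is the random (possibly infinite) plane family tree of a branching process started from one individual in which every individual independently has a number of children with law $\mu$; equivalently, for every finite plane tree $t$, $\mathbb{P}(T_\mu=t)=\prod_{v\in t}\mu(\mathrm{k}_v(t))$, where $\mathrm{k}_v(t)$ is the number of children of $v$ in $t$. $T_{\mu,n}$ has the law of $T_\mu$ conditioned on $\{\#T_\mu=n\}$. $\log$ is the natural logarithm. *)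

theory Defs
  imports "HOL-Probability.Probability"
begin

text \<open>
  Plane trees, finite or infinite, in the Ulam--Harris encoding: the empty word is the root, and
  the children of a vertex \<open>u\<close> with \<open>m\<close> children are \<open>u @ [0], \<dots>, u @ [m - 1]\<close>, in this order.
  Hence the distance of \<open>u\<close> to the root is \<open>length u\<close>, and the size of a finite tree is \<open>card\<close>.
  An infinite tree has \<open>card\<close> zero, so the event \<open>card t = n\<close> with \<open>n > 0\<close> entails finiteness.
\<close>

definition plane_tree :: "nat list set \<Rightarrow> bool" where
  "plane_tree t \<longleftrightarrow> [] \<in> t \<and> (\<forall>u i. u @ [i] \<in> t \<longrightarrow> u \<in> t) \<and>
     (\<forall>u\<in>t. \<exists>m. \<forall>i. u @ [i] \<in> t \<longleftrightarrow> i < m)"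

definition num_children :: "nat list set \<Rightarrow> nat list \<Rightarrow> nat" where
  "num_children t u = card {i. u @ [i] \<in> t}"

text \<open>Height and width are meaningful for finite trees only: \<open>Max\<close> is unspecified on infinite sets.\<close>

definition Ht :: "nat list set \<Rightarrow> nat" where
  "Ht t = Max (length ` t)"

definition Wd :: "nat list set \<Rightarrow> nat" where
  "Wd t = Max (range (\<lambda>h. card {u \<in> t. length u = h}))"

text \<open>The family tree in which the individual \<open>u\<close>, if it is ever born, has \<open>k u\<close> children.\<close>

definition family_tree :: "(nat list \<Rightarrow> nat) \<Rightarrow> nat list set" where
  "family_tree k = {u. \<forall>i<length u. u ! i < k (take i u)}"

text \<open>The space of plane trees with the \<open>\<sigma>\<close>-algebra generated by the events \<open>u \<in> t\<close>.\<close>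

definition plane_tree_space :: "nat list set measure" where
  "plane_tree_space = sigma {t. plane_tree t} (range (\<lambda>u. {t. plane_tree t \<and> u \<in> t}))"

text \<open>
  The law of the family tree of independent individuals with offspring distribution \<open>\<mu>\<close>.
  The map \<open>family_tree\<close> is measurable, see \<open>measurable_family_tree\<close> below.
\<close>

definition bienayme_law :: "nat pmf \<Rightarrow> nat list set measure" where
  "bienayme_law \<mu> = distr (PiM UNIV (\<lambda>_. measure_pmf \<mu>)) plane_tree_space family_tree"

definition bienayme_tree :: "'w measure \<Rightarrow> nat pmf \<Rightarrow> ('w \<Rightarrow> nat list set) \<Rightarrow> bool" where
  "bienayme_tree M \<mu> T \<longleftrightarrow> prob_space M \<and> T \<in> M \<rightarrow>\<^sub>M plane_tree_space \<and>
     distr M plane_tree_space T = bienayme_law \<mu>"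

lemma Nil_in_family_tree: "[] \<in> family_tree k"
  by (simp add: family_tree_def)

lemma snoc_in_family_tree: "u @ [i] \<in> family_tree k \<longleftrightarrow> u \<in> family_tree k \<and> i < k u"
  by (auto simp: family_tree_def nth_append less_Suc_eq)

lemma plane_tree_family_tree: "plane_tree (family_tree k)"
  unfolding plane_tree_def by (auto simp: Nil_in_family_tree snoc_in_family_tree)

lemma space_plane_tree_space [simp]: "space plane_tree_space = {t. plane_tree t}"
  unfolding plane_tree_space_def by (rule space_measure_of) auto

lemma sets_plane_tree_space:
  "sets plane_tree_space = sigma_sets {t. plane_tree t} (range (\<lambda>u. {t. plane_tree t \<and> u \<in> t}))"
  unfolding plane_tree_space_def by (rule sets_measure_of) auto

lemma measurable_family_tree:
  "family_tree \<in> PiM UNIV (\<lambda>_. measure_pmf \<mu>) \<rightarrow>\<^sub>M plane_tree_space"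
  unfolding plane_tree_space_def
proof (rule measurable_measure_of)
  fix A assume "A \<in> range (\<lambda>u. {t. plane_tree t \<and> u \<in> t})"
  then obtain u where A: "A = {t. plane_tree t \<and> u \<in> t}" by auto
  have "{k \<in> space (PiM UNIV (\<lambda>_. measure_pmf \<mu>)). \<forall>i\<in>{..<length u}. u ! i < k (take i u)}
      \<in> sets (PiM UNIV (\<lambda>_. measure_pmf \<mu>))"
  proof (rule sets.sets_Collect_finite_All, goal_cases)
    case (1 i)
    have "(\<lambda>k. k (take i u)) \<in> PiM UNIV (\<lambda>_. measure_pmf \<mu>) \<rightarrow>\<^sub>M measure_pmf \<mu>"
      by (rule measurable_component_singleton) simp
    from measurable_sets[OF this, of "{x. u ! i < x}"] show ?case
      by (simp add: vimage_def Int_def conj_commute)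
  qed auto
  also have "{k \<in> space (PiM UNIV (\<lambda>_. measure_pmf \<mu>)). \<forall>i\<in>{..<length u}. u ! i < k (take i u)}
      = family_tree -` A \<inter> space (PiM UNIV (\<lambda>_. measure_pmf \<mu>))"
    unfolding A using plane_tree_family_tree by (auto simp: family_tree_def)
  finally show "family_tree -` A \<inter> space (PiM UNIV (\<lambda>_. measure_pmf \<mu>))
      \<in> sets (PiM UNIV (\<lambda>_. measure_pmf \<mu>))" .
qed (use plane_tree_family_tree in auto)

lemma sets_plane_tree_space_singleton:
  assumes "plane_tree t"
  shows "{t} \<in> sets plane_tree_space"
proof -
  have gen: "{t'. plane_tree t' \<and> u \<in> t'} \<in> sets plane_tree_space" for u
    unfolding sets_plane_tree_space by (rule sigma_sets.Basic) auto
  have "{t' \<in> space plane_tree_space. \<forall>u. u \<in> t' \<longleftrightarrow> u \<in> t} \<in> sets plane_tree_space"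
  proof (rule sets.sets_Collect_countable_All)
    fix u
    show "{t' \<in> space plane_tree_space. u \<in> t' \<longleftrightarrow> u \<in> t} \<in> sets plane_tree_space"
    proof (cases "u \<in> t")
      case True then show ?thesis using gen[of u] by simp
    next
      case False
      have "space plane_tree_space - {t'. plane_tree t' \<and> u \<in> t'} \<in> sets plane_tree_space"
        using gen[of u] by blast
      also have "space plane_tree_space - {t'. plane_tree t' \<and> u \<in> t'}
          = {t' \<in> space plane_tree_space. u \<in> t' \<longleftrightarrow> u \<in> t}"
        using False by auto
      finally show ?thesis .
    qed
  qed
  also have "{t' \<in> space plane_tree_space. \<forall>u. u \<in> t' \<longleftrightarrow> u \<in> t} = {t}"
    using assms by auto
  finally show ?thesis .
qed

lemma num_children_iff:
  assumes "plane_tree t" "u \<in> t"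
  shows "u @ [i] \<in> t \<longleftrightarrow> i < num_children t u"
proof -
  obtain m where m: "\<And>i. u @ [i] \<in> t \<longleftrightarrow> i < m"
    using assms unfolding plane_tree_def by blast
  then have "{i. u @ [i] \<in> t} = {..<m}" by auto
  then show ?thesis by (simp add: m num_children_def)
qed

lemma family_tree_eq_iff:
  assumes t: "plane_tree t"
  shows "family_tree k = t \<longleftrightarrow> (\<forall>u\<in>t. k u = num_children t u)"
proof
  assume eq: "family_tree k = t"
  show "\<forall>u\<in>t. k u = num_children t u"
  proof
    fix u assume "u \<in> t"
    then have "{i. u @ [i] \<in> t} = {..<k u}" using snoc_in_family_tree[of u _ k] eq by auto
    then show "k u = num_children t u" by (simp add: num_children_def)
  qed
next
  assume *: "\<forall>u\<in>t. k u = num_children t u"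
  have "u \<in> family_tree k \<longleftrightarrow> u \<in> t" for u
  proof (induction u rule: rev_induct)
    case Nil then show ?case using t by (simp add: Nil_in_family_tree plane_tree_def)
  next
    case (snoc i u)
    have "u @ [i] \<in> t \<Longrightarrow> u \<in> t" using t by (auto simp: plane_tree_def)
    then show ?case using snoc * num_children_iff[OF t, of u i]
      by (auto simp: snoc_in_family_tree)
  qed
  then show "family_tree k = t" by blast
qed

lemma prob_bienayme_tree_eq:
  assumes T: "bienayme_tree M \<mu> T" and t: "plane_tree t" "finite t"
  shows "\<P>(w in M. T w = t) = (\<Prod>v\<in>t. pmf \<mu> (num_children t v))"
proof -
  interpret P: product_prob_space "\<lambda>_::nat list. measure_pmf \<mu>" UNIV
    by unfold_locales
  let ?P = "PiM UNIV (\<lambda>_::nat list. measure_pmf \<mu>)"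
  have "\<P>(w in M. T w = t) = measure M (T -` {t} \<inter> space M)"
    by (rule arg_cong[where f = "measure M"]) auto
  also have "\<dots> = measure (distr M plane_tree_space T) {t}"
    using T t by (subst measure_distr) (auto simp: bienayme_tree_def sets_plane_tree_space_singleton)
  also have "\<dots> = measure (bienayme_law \<mu>) {t}"
    using T by (simp add: bienayme_tree_def)
  also have "\<dots> = measure ?P (family_tree -` {t} \<inter> space ?P)"
    unfolding bienayme_law_def using t
    by (subst measure_distr) (auto simp: measurable_family_tree sets_plane_tree_space_singleton)
  also have "family_tree -` {t} \<inter> space ?P
      = prod_emb UNIV (\<lambda>_. measure_pmf \<mu>) t (PiE t (\<lambda>v. {num_children t v}))"
    using family_tree_eq_iff[OF t(1)]
    by (auto simp: prod_emb_def space_PiM restrict_def PiE_def extensional_def Pi_def)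
  also have "measure ?P \<dots> = (\<Prod>v\<in>t. measure (measure_pmf \<mu>) {num_children t v})"
    using t by (intro P.measure_PiM_emb) auto
  finally show ?thesis by (simp add: pmf.rep_eq)
qed

end

theory Submission
  imports Defs
begin

text \<open>
  Conditionally on the multiset \<open>D\<close> of its offspring numbers, the tree is uniform, so it suffices to
  treat a uniform tree with \<open>n\<close> vertices and given \<open>D\<close>. Put \<open>\<sigma>\<^sup>2 = (\<Sum>x\<in>#D. (x - 1)\<^sup>2)\<close>. The width is of order
  at most \<open>\<sigma>\<close> and the height of order at most \<open>n ln n / \<sigma>\<close>.

  Width: the breadth-first queue is an excursion whose random cyclic shift is a uniform arrangement
  of \<open>D\<close> (cycle lemma). The mean of the part of the arrangement not yet seen is a martingale, and its
  maximal inequality gives \<open>P (Wd > t \<sigma>) \<le> 128 / t\<^sup>2\<close>.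

  Height: it is at least \<open>h\<close> only if every level \<open>g \<le> h\<close> is occupied. The mean size of level \<open>g\<close> is at
  most \<open>n\<close> times the mean product of the first \<open>g\<close> entries of a uniform arrangement of \<open>D\<close>, that is
  \<open>n * e\<^sub>g(D) / (n choose g)\<close> with \<open>e\<^sub>g\<close> elementary symmetric. Multiplying by \<open>(n choose g) * \<theta> ^ g\<close> and
  summing over \<open>g\<close> bounds the probability by \<open>2 * n * (\<Prod>x\<in>#D. 1 + \<theta> * x) / (1 + \<theta>) ^ n\<close> for \<open>\<theta> = h / (2 n)\<close>,
  which decays like \<open>exp (- h \<sigma> / (16 n))\<close>.

  With \<open>t = s / 32\<close> the sum of both probabilities is at most \<open>4 / s\<close>. For \<open>s \<le> 10 ^ 13\<close> the claimed bound
  exceeds one.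
\<close>

section \<open>Arrangements of a multiset\<close>

abbreviation arrangements :: "'a multiset \<Rightarrow> 'a list set" where
  "arrangements \<equiv> permutations_of_multiset"

lemma sum_mset_conv_sum_set:
  fixes g :: "'a \<Rightarrow> real"
  shows "(\<Sum>x\<in>#E. g x) = (\<Sum>x\<in>set_mset E. real (count E x) * g x)"
proof (induction E)
  case empty then show ?case by simp
next
  case (add y E)
  have *: "(\<Sum>x\<in>insert y (set_mset E). real (count (add_mset y E) x) * g x)
      = g y + (\<Sum>x\<in>insert y (set_mset E). real (count E x) * g x)"
    by (subst (1 2) sum.remove[of _ y]) (auto simp: algebra_simps intro!: sum.cong split: if_splits)
  have "(\<Sum>x\<in>insert y (set_mset E). real (count E x) * g x)
      = (\<Sum>x\<in>set_mset E. real (count E x) * g x)"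
    by (rule sum.mono_neutral_right) (auto simp: not_in_iff)
  with * add show ?case by simp
qed

lemma sum_arrangements_first:
  assumes "E \<noteq> {#}"
  shows "(\<Sum>xs\<in>arrangements E. f xs)
       = (\<Sum>x\<in>set_mset E. \<Sum>xs\<in>arrangements (E - {#x#}). f (x # xs))"
  unfolding permutations_of_multiset_nonempty[OF assms]
  by (subst sum.UNION_disjoint) (auto simp: sum.reindex)

text \<open>A uniform arrangement starts with \<open>x\<close> with probability
  \<open>count E x / size E\<close>, so the mean of a function of the first entry is its average
  over \<open>E\<close>.\<close>

lemma sum_card_arrangements_remove:
  fixes g :: "'a \<Rightarrow> real"
  assumes "E \<noteq> {#}"
  shows "(\<Sum>x\<in>set_mset E. real (card (arrangements (E - {#x#}))) * g x)
       = real (card (arrangements E)) / real (size E) * (\<Sum>x\<in>#E. g x)"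
  unfolding sum_mset_conv_sum_set sum_distrib_left
  by (rule sum.cong) (auto simp: real_card_permutations_of_multiset_remove)

section \<open>A maximal inequality for drawing without replacement\<close>

lemma sum_mset_remove1:
  fixes g :: "'a \<Rightarrow> real"
  assumes "x \<in># E"
  shows "(\<Sum>y\<in>#E - {#x#}. g y) = (\<Sum>y\<in>#E. g y) - g x"
  using assms by (metis add_diff_cancel_left' insert_DiffM image_mset_add_mset sum_mset.add_mset)

text \<open>With \<open>k = m - 1\<close>, summing over the drawn element gives
  \<open>s\<^sup>2\<close> the coefficient \<open>(k - 1) / k\<^sup>2\<close>, which is at most
  \<open>1 / (k + 1)\<close>, and raises that of \<open>q\<close> by \<open>1 / k\<^sup>2\<close>,
  which \<open>c - c'\<close> absorbs.\<close>

lemma mean_supermartingale_step: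
  fixes g :: "'a \<Rightarrow> real" and c c' :: real
  defines "S1 \<equiv> \<lambda>E. \<Sum>x\<in>#E. g x" and "S2 \<equiv> \<lambda>E. \<Sum>x\<in>#E. (g x)\<^sup>2"
  assumes m: "size E = m" "m \<ge> 2" and c: "c \<ge> c' + 1 / (real m - 1)\<^sup>2"
  shows "(\<Sum>x\<in>#E. (S1 (E - {#x#}) / (real m - 1))\<^sup>2 + c' * (S2 (E - {#x#}) / (real m - 1)))
       \<le> real m * ((S1 E / real m)\<^sup>2 + c * (S2 E / real m))"
proof -
  define s q k where "s = S1 E" and "q = S2 E" and "k = real m - 1"
  have k: "k \<ge> 1" "real m = k + 1" using m by (auto simp: k_def)
  have q0: "q \<ge> 0"
    unfolding q_def S2_def sum_mset_conv_sum_set by (intro sum_nonneg) auto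
  have "(\<Sum>x\<in>#E. (S1 (E - {#x#}) / k)\<^sup>2 + c' * (S2 (E - {#x#}) / k))
      = (\<Sum>x\<in>#E. (s / k)\<^sup>2 + c' * (q / k) + (- 2 * s / k\<^sup>2) * g x + (1 / k\<^sup>2 - c' / k) * (g x)\<^sup>2)"
  proof (intro arg_cong[where f = sum_mset] image_mset_cong)
    fix x assume x: "x \<in># E"
    have "((s - g x) / k)\<^sup>2 + c' * ((q - (g x)\<^sup>2) / k)
        = (s / k)\<^sup>2 + c' * (q / k) + (- 2 * s / k\<^sup>2) * g x + (1 / k\<^sup>2 - c' / k) * (g x)\<^sup>2"
      using k(1) by (simp add: field_simps power2_eq_square)
    then show "(S1 (E - {#x#}) / k)\<^sup>2 + c' * (S2 (E - {#x#}) / k)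
        = (s / k)\<^sup>2 + c' * (q / k) + (- 2 * s / k\<^sup>2) * g x + (1 / k\<^sup>2 - c' / k) * (g x)\<^sup>2"
      using x by (simp add: S1_def S2_def sum_mset_remove1 s_def q_def)
  qed
  also have "\<dots> = real m * ((s / k)\<^sup>2 + c' * (q / k)) + (- 2 * s / k\<^sup>2) * s + (1 / k\<^sup>2 - c' / k) * q"
    by (simp add: sum_mset.distrib s_def q_def S1_def S2_def m sum_mset_distrib_left)
  also have "\<dots> = (k - 1) * s\<^sup>2 / k\<^sup>2 + (1 / k\<^sup>2 + c') * q"
    unfolding k(2) using k(1) by (simp add: field_simps power2_eq_square)
  also have "\<dots> \<le> s\<^sup>2 / (k + 1) + c * q"
  proof (rule add_mono)
    have "(k - 1) * (k + 1) \<le> k\<^sup>2" by (simp add: power2_eq_square algebra_simps)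
    then have "(k - 1) / k\<^sup>2 \<le> 1 / (k + 1)" using k(1) by (simp add: divide_simps)
    from mult_right_mono[OF this, of "s\<^sup>2"] show "(k - 1) * s\<^sup>2 / k\<^sup>2 \<le> s\<^sup>2 / (k + 1)" by simp
    show "(1 / k\<^sup>2 + c') * q \<le> c * q" using c q0 by (intro mult_right_mono) (auto simp: k_def)
  qed
  also have "\<dots> = real m * ((s / real m)\<^sup>2 + c * (q / real m))"
    unfolding k(2)[symmetric] using m by (simp add: field_simps power2_eq_square)
  finally show ?thesis unfolding s_def q_def k_def by simp
qed

text \<open>
  The mean of the elements not yet drawn is a martingale; the second summand on the right-hand
  side compensates its square.
\<close>

lemma maximal_inequality_arrangements:
  fixes g :: "'a \<Rightarrow> real" and a :: real
  assumes a: "a > 0" and m0: "2 \<le> m0" "m0 \<le> size E"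
  shows "a\<^sup>2 * real (card {xs \<in> arrangements E. \<exists>j \<le> size E - m0.
             a \<le> \<bar>sum_list (map g (drop j xs))\<bar> / real (size E - j)})
       \<le> real (card (arrangements E)) * (((\<Sum>x\<in>#E. g x) / real (size E))\<^sup>2 +
           (1 / (real m0 - 1) - 1 / (real (size E) - 1)) * ((\<Sum>x\<in>#E. (g x)\<^sup>2) / real (size E)))"
  using m0(2)
proof (induction "size E - m0" arbitrary: E)
  \<comment> \<open>Only \<open>j = 0\<close> is possible, so all arrangements or none satisfy the
    event; the coefficient of the squares is zero here.\<close>
  case (0 E)
  then have eq: "size E = m0" by simp
  let ?S = "\<Sum>x\<in>#E. g x"
  have S: "sum_list (map g xs) = ?S" if "xs \<in> arrangements E" for xs
    using permutations_of_multisetD[OF that] by (metis mset_map sum_mset_sum_list)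
  show ?case
  proof (cases "a \<le> \<bar>?S\<bar> / real m0")
    case True
    then have "a\<^sup>2 \<le> (\<bar>?S\<bar> / real m0)\<^sup>2" using a by (intro power_mono) auto
    then have *: "a\<^sup>2 \<le> (?S / real m0)\<^sup>2" by (simp add: power_divide)
    have "{xs \<in> arrangements E. \<exists>j \<le> size E - m0.
             a \<le> \<bar>sum_list (map g (drop j xs))\<bar> / real (size E - j)} = arrangements E"
      using True S eq by auto
    then show ?thesis using * eq by (simp add: mult.commute mult_left_mono)
  next
    case False
    then have none: "{xs \<in> arrangements E. \<exists>j \<le> size E - m0.
             a \<le> \<bar>sum_list (map g (drop j xs))\<bar> / real (size E - j)} = {}"
      using S eq by auto
    show ?thesis unfolding none using eq by simp
  qed
next
  case (Suc k E)
  define m where "m = size E"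
  have m: "m > m0" "m \<ge> 3" using Suc m0 by (auto simp: m_def)
  have E: "E \<noteq> {#}" using m by (auto simp: m_def)
  let ?S = "\<lambda>E. \<Sum>x\<in>#E. g x" and ?Q = "\<lambda>E. \<Sum>x\<in>#E. (g x)\<^sup>2"
  let ?c = "\<lambda>m. 1 / (real m0 - 1) - 1 / (m - 1)"
  let ?P = "\<lambda>E xs. \<exists>j \<le> size E - m0. a \<le> \<bar>sum_list (map g (drop j xs))\<bar> / real (size E - j)"
  have Q0: "?Q E \<ge> 0"
    unfolding sum_mset_conv_sum_set by (intro sum_nonneg) auto
  have c0: "?c (real m) \<ge> 0" using m m0 by (simp add: frac_le)
  \<comment> \<open>If the mean of \<open>E\<close> itself reaches \<open>a\<close>, all
    arrangements may be counted. Otherwise the event is decided by what follows the first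
    draw.\<close>
  show ?case
  proof (cases "a \<le> \<bar>?S E\<bar> / real m")
    case True
    then have "a\<^sup>2 \<le> (\<bar>?S E\<bar> / real m)\<^sup>2" using a by (intro power_mono) auto
    then have "a\<^sup>2 \<le> (?S E / real m)\<^sup>2" by (simp add: power_divide)
    also have "\<dots> \<le> (?S E / real m)\<^sup>2 + ?c (real m) * (?Q E / real m)"
      using Q0 c0 by simp
    finally have *: "a\<^sup>2 \<le> (?S E / real m)\<^sup>2 + ?c (real m) * (?Q E / real m)" .
    have "card {xs \<in> arrangements E. ?P E xs} \<le> card (arrangements E)"
      by (intro card_mono) auto
    then have "a\<^sup>2 * real (card {xs \<in> arrangements E. ?P E xs})
        \<le> ((?S E / real m)\<^sup>2 + ?c (real m) * (?Q E / real m)) * real (card (arrangements E))"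
      using * by (intro mult_mono) (auto intro: order.trans[OF zero_le_power2])
    then show ?thesis by (simp add: m_def mult.commute)
  next
    case False
    have size_rm: "size (E - {#x#}) = m - 1" if "x \<in># E" for x
      using that by (simp add: m_def size_Diff_singleton)
    \<comment> \<open>Index 0 is excluded by the case assumption, so a crossing for
      \<open>x # xs\<close> is one for \<open>xs\<close> with the index shifted by one.\<close>
    have Pcons: "?P E (x # xs) \<longleftrightarrow> ?P (E - {#x#}) xs"
      if x: "x \<in># E" and xs: "xs \<in> arrangements (E - {#x#})" for x xs
    proof -
      have "mset (x # xs) = E" using x permutations_of_multisetD[OF xs] by simp
      then have S: "sum_list (map g (x # xs)) = ?S E" by (metis mset_map sum_mset_sum_list)
      have "?P E (x # xs) \<longleftrightarrow> (\<exists>j. Suc j \<le> m - m0 \<and> a \<le> \<bar>sum_list (map g (drop j xs))\<bar> / real (m - Suc j))"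
      proof
        assume "?P E (x # xs)"
        then obtain j where j: "j \<le> m - m0"
          "a \<le> \<bar>sum_list (map g (drop j (x # xs)))\<bar> / real (m - j)" by (auto simp: m_def)
        then show "\<exists>j. Suc j \<le> m - m0 \<and> a \<le> \<bar>sum_list (map g (drop j xs))\<bar> / real (m - Suc j)"
          using False S by (cases j) auto
      next
        assume "\<exists>j. Suc j \<le> m - m0 \<and> a \<le> \<bar>sum_list (map g (drop j xs))\<bar> / real (m - Suc j)"
        then obtain j where "Suc j \<le> m - m0" "a \<le> \<bar>sum_list (map g (drop j xs))\<bar> / real (m - Suc j)"
          by auto
        then show "?P E (x # xs)" unfolding m_def by (intro exI[of _ "Suc j"]) auto
      qed
      also have "\<dots> \<longleftrightarrow> ?P (E - {#x#}) xs"
      proof -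
        have "Suc j \<le> m - m0 \<longleftrightarrow> j \<le> m - 1 - m0" "m - Suc j = m - 1 - j" for j using m by auto
        then show ?thesis by (simp only: size_rm[OF x])
      qed
      finally show ?thesis .
    qed
    let ?N = "\<lambda>E. real (card {xs \<in> arrangements E. ?P E xs})"
    have ind: "real (card {xs \<in> A. R xs}) = (\<Sum>xs\<in>A. if R xs then 1 else 0)"
      if "finite A" for A :: "'a list set" and R
      using that by (simp add: sum.If_cases Int_def)
    have "?N E = (\<Sum>x\<in>set_mset E. \<Sum>xs\<in>arrangements (E - {#x#}). if ?P E (x # xs) then 1 else 0)"
      by (simp only: ind[OF finite_permutations_of_multiset] sum_arrangements_first[OF E])
    also have "\<dots> = (\<Sum>x\<in>set_mset E. ?N (E - {#x#}))"
      by (simp only: ind[OF finite_permutations_of_multiset]) (simp only: Pcons cong: sum.cong)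
    finally have "a\<^sup>2 * ?N E = (\<Sum>x\<in>set_mset E. a\<^sup>2 * ?N (E - {#x#}))"
      by (simp add: sum_distrib_left)
    also have "\<dots> \<le> (\<Sum>x\<in>set_mset E. real (card (arrangements (E - {#x#}))) *
        ((?S (E - {#x#}) / (real m - 1))\<^sup>2 + ?c (real m - 1) * (?Q (E - {#x#}) / (real m - 1))))"
    proof (rule sum_mono)
      fix x assume x: "x \<in> set_mset E"
      have "k = size (E - {#x#}) - m0" "m0 \<le> size (E - {#x#})"
        using Suc(2) size_rm[OF x] m by (auto simp: m_def)
      from Suc(1)[OF this] size_rm[OF x] m
      show "a\<^sup>2 * ?N (E - {#x#}) \<le> real (card (arrangements (E - {#x#}))) *
        ((?S (E - {#x#}) / (real m - 1))\<^sup>2 + ?c (real m - 1) * (?Q (E - {#x#}) / (real m - 1)))"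
        by (simp add: of_nat_diff)
    qed
    also have "\<dots> = real (card (arrangements E)) / real m *
        (\<Sum>x\<in>#E. (?S (E - {#x#}) / (real m - 1))\<^sup>2 + ?c (real m - 1) * (?Q (E - {#x#}) / (real m - 1)))"
      by (subst sum_card_arrangements_remove[OF E]) (simp add: m_def)
    also have "\<dots> \<le> real (card (arrangements E)) / real m *
        (real m * ((?S E / real m)\<^sup>2 + ?c (real m) * (?Q E / real m)))"
    proof (rule mult_left_mono[OF mean_supermartingale_step])
      \<comment> \<open>The coefficients telescope: \<open>1 / ((m - 1) * (m - 2))\<close> is the
        increment of \<open>?c\<close>.\<close>
      have "1 / (real m - 1)\<^sup>2 \<le> 1 / ((real m - 1) * (real m - 2))"
        using m by (intro divide_left_mono) (auto simp: power2_eq_square)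
      also have "\<dots> = 1 / (real m - 2) - 1 / (real m - 1)" using m by (simp add: field_simps)
      finally show "?c (real m - 1) + 1 / (real m - 1)\<^sup>2 \<le> ?c (real m)" by simp
    qed (use m m_def in auto)
    finally show ?thesis using E by (simp add: m_def)
  qed
qed

section \<open>The cycle lemma\<close>

text \<open>
  For the offspring numbers \<open>xs\<close> of a tree in breadth-first order, \<open>1 + sum_list (take j xs) - j\<close> is
  the length of the queue after \<open>j\<close> steps; the terms are moved here so that no subtraction occurs.
\<close>

definition excursion :: "nat list \<Rightarrow> bool" where
  "excursion xs \<longleftrightarrow> sum_list xs + 1 = length xs \<and> (\<forall>j<length xs. j \<le> sum_list (take j xs))"

text \<open>The \<open>j\<close> entries starting at position \<open>i\<close> either end inside
  \<open>xs\<close> or wrap around.\<close>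

lemma sum_list_take_rotate:
  fixes xs :: "nat list"
  assumes "i \<le> length xs" "j \<le> length xs"
  shows "sum_list (take j (rotate i xs)) + sum_list (take i xs)
    = (if i + j \<le> length xs then sum_list (take (i + j) xs)
       else sum_list xs + sum_list (take (i + j - length xs) xs))"
proof -
  have rot: "rotate i xs = drop i xs @ take i xs"
  proof (cases "i = length xs")
    case False
    then show ?thesis using assms by (subst rotate_drop_take) simp
  qed simp
  have tot: "sum_list (drop i xs) + sum_list (take i xs) = sum_list xs"
    using sum_list_append[of "take i xs" "drop i xs"] by simp
  show ?thesis
  proof (cases "i + j \<le> length xs")
    case True
    then have "take j (rotate i xs) = take j (drop i xs)" unfolding rot by simp
    moreover have "take (i + j) xs = take i xs @ take j (drop i xs)" by (rule take_add)
    ultimately have "sum_list (take j (rotate i xs)) + sum_list (take i xs) = sum_list (take (i + j) xs)"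
      by (simp only: sum_list_append add.commute)
    with True show ?thesis by (simp only: if_True)
  next
    case False
    then have "take j (rotate i xs) = drop i xs @ take (i + j - length xs) xs"
      using assms unfolding rot
      by (simp only: take_append length_drop take_take take_all) (simp add: add.commute)
    then have "sum_list (take j (rotate i xs)) + sum_list (take i xs)
        = sum_list xs + sum_list (take (i + j - length xs) xs)"
      by (simp only: sum_list_append tot[symmetric] add_ac)
    with False show ?thesis by (simp only: if_False)
  qed
qed

lemma mset_rotate: "mset (rotate i xs) = mset xs"
  by (metis append_take_drop_id mset_append rotate_drop_take union_commute)

text \<open>The rotation starts where the path \<open>sum_list (take j xs) - j\<close> first attains
  its minimum. Later values are at least the minimum, and earlier ones exceed it by at least one,
  which makes up for the total increment -1 after wrapping around.\<close>

lemma excursion_rotate_exists: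
  assumes "sum_list xs + 1 = length xs"
  shows "\<exists>i<length xs. excursion (rotate i xs)"
proof -
  define n where "n = length xs"
  define P where "P j = int (sum_list (take j xs)) - int j" for j
  define m where "m = Min (P ` {..n})"
  have m_le: "m \<le> P j" if "j \<le> n" for j unfolding m_def using that by (intro Min_le) auto
  have "m \<in> P ` {..n}" unfolding m_def by (intro Min_in) auto
  then have ex: "\<exists>i. i \<le> n \<and> P i = m" by auto
  define i where "i = (LEAST i. i \<le> n \<and> P i = m)"
  have i: "i \<le> n" "P i = m" using LeastI_ex[OF ex] by (auto simp: i_def)
  have before: "P j > m" if "j < i" for j
    using not_less_Least[of j "\<lambda>i. i \<le> n \<and> P i = m"] that i m_le[of j] by (auto simp: i_def)
  have Pn: "P n = -1" "P 0 = 0" using assms by (auto simp: P_def n_def)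
  have i0: "i \<noteq> 0" using m_le[of n] Pn i(2) by (intro notI) simp
  have "excursion (rotate i xs)"
    unfolding excursion_def
  proof (intro conjI allI impI)
    have "mset (rotate i xs) = mset xs" by (rule mset_rotate)
    then have "sum_list (rotate i xs) = sum_list xs" by (metis sum_mset_sum_list)
    then show "sum_list (rotate i xs) + 1 = length (rotate i xs)" using assms by simp
    fix j assume "j < length (rotate i xs)"
    then have j: "j < n" by (simp add: n_def)
    show "j \<le> sum_list (take j (rotate i xs))"
    proof (cases "i + j \<le> n")
      case True
      then show ?thesis
        using sum_list_take_rotate[of i xs j] i j m_le[of "i + j"] by (auto simp: P_def n_def)
    next
      case False
      then have "i + j - n < i" using j by auto
      from before[OF this] show ?thesis
        using False sum_list_take_rotate[of i xs j] i j assms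
        by (auto simp: P_def n_def of_nat_diff)
    qed
  qed
  note rot = this
  show ?thesis
  proof (cases "i = n")
    \<comment> \<open>The minimum may first be attained at the end, and rotating by \<open>n\<close>
      is rotating by 0.\<close>
    case True
    then have "excursion (rotate 0 xs)" using rot by (simp add: n_def)
    moreover have "0 < length xs" using assms by linarith
    ultimately show ?thesis by blast
  next
    case False
    then have "i < length xs" using i(1) unfolding n_def by simp
    then show ?thesis using rot by blast
  qed
qed

text \<open>Cut \<open>xs\<close> at \<open>k\<close>: both pieces are initial pieces of excursions,
  so for \<open>k\<close> nonzero they sum to at least \<open>k\<close> and
  \<open>length xs - k\<close>, whereas the total is only \<open>length xs - 1\<close>.\<close>

lemma excursion_rotate_imp_0:
  assumes xs: "excursion xs" "excursion (rotate k xs)" and k: "k < length xs"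
  shows "k = 0"
proof (rule ccontr)
  assume k0: "k \<noteq> 0"
  let ?j = "length xs - k"
  have "k \<le> sum_list (take k xs)" "?j \<le> sum_list (take ?j (rotate k xs))"
    using xs k k0 by (auto simp: excursion_def)
  moreover have "sum_list (take ?j (rotate k xs)) + sum_list (take k xs) = sum_list xs"
    using sum_list_take_rotate[of k xs ?j] k by simp
  moreover have "sum_list xs + 1 = length xs" using xs(1) unfolding excursion_def by blast
  ultimately show False using k by linarith
qed

text \<open>Undoing the rotations turns a coincidence into one excursion being the rotation of the
  other by \<open>j - i\<close>, which must then be 0.\<close>

lemma inj_on_rotate_excursion:
  "inj_on (\<lambda>(xs, i). rotate i xs) ({xs. excursion xs \<and> length xs = n} \<times> {..<n})"
proof -
  have *: "xs = ys \<and> i = j"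
    if "excursion xs" "excursion ys" "length xs = n" "length ys = n" "i \<le> j" "j < n"
      "rotate i xs = rotate j ys" for xs ys :: "nat list" and i j
  proof -
    have ij: "i + (j - i) = j" "n - i + i = n" using that(5,6) by simp_all
    have n_xs: "rotate n zs = zs" if "length zs = n" for zs :: "nat list"
      by (rule rotate_id) (simp only: that mod_self)
    have "xs = rotate (n - i) (rotate i xs)"
      by (simp only: rotate_rotate ij n_xs that(3))
    also have "\<dots> = rotate (n - i) (rotate i (rotate (j - i) ys))"
      by (simp only: that(7) rotate_rotate[of i "j - i"] ij)
    also have "\<dots> = rotate (j - i) ys"
      by (simp only: rotate_rotate[of "n - i" i] ij n_xs that(4) length_rotate)
    finally have eq: "xs = rotate (j - i) ys" .
    have "j - i = 0"
    proof (rule excursion_rotate_imp_0)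
      show "excursion ys" "excursion (rotate (j - i) ys)" "j - i < length ys"
        using that(1,2,4,6) unfolding eq[symmetric] by simp_all
    qed
    then have "i = j" using that(5) by simp
    then show ?thesis unfolding eq by simp
  qed
  show ?thesis
  proof (rule inj_onI)
    fix p q :: "nat list \<times> nat"
    assume "p \<in> {xs. excursion xs \<and> length xs = n} \<times> {..<n}"
      "q \<in> {xs. excursion xs \<and> length xs = n} \<times> {..<n}"
      "(\<lambda>(xs, i). rotate i xs) p = (\<lambda>(xs, i). rotate i xs) q"
    then show "p = q"
      using *[of "fst p" "fst q" "snd p" "snd q"] *[of "fst q" "fst p" "snd q" "snd p"]
        nat_le_linear[of "snd p" "snd q"]
      by (cases p; cases q) (simp, metis)
  qed
qed

lemma arrangements_rotate: "xs \<in> arrangements D \<Longrightarrow> rotate i xs \<in> arrangements D"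
  by (simp add: permutations_of_multiset_def mset_rotate)

lemma arrangements_conv_rotate_excursion:
  assumes D: "sum_mset D + 1 = size D"
  shows "arrangements D
    = (\<lambda>(xs, i). rotate i xs) ` ({xs \<in> arrangements D. excursion xs} \<times> {..<size D})"
proof (intro equalityI subsetI)
  fix zs assume zs: "zs \<in> arrangements D"
  then have len: "length zs = size D" and "sum_list zs = sum_mset D"
    using permutations_of_multisetD[OF zs] by (auto simp: sum_mset_sum_list[symmetric])
  with excursion_rotate_exists[of zs] D obtain i where i: "i < size D" "excursion (rotate i zs)"
    by auto
  \<comment> \<open>The inverse shift; it has to stay below \<open>size D\<close>, hence the
    separate value at \<open>i = 0\<close>.\<close>
  define k where "k = (if i = 0 then 0 else size D - i)"
  have "rotate k (rotate i zs) = zs" using i len by (auto simp: k_def rotate_rotate)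
  moreover have "k < size D" using i by (auto simp: k_def)
  ultimately show "zs \<in> (\<lambda>(xs, i). rotate i xs) ` ({xs \<in> arrangements D. excursion xs} \<times> {..<size D})"
    using i(2) arrangements_rotate[OF zs, of i]
    by (intro image_eqI[of _ _ "(rotate i zs, k)"]) auto
qed (auto intro: arrangements_rotate)

lemma inj_on_rotate_excursion_arrangements:
  "inj_on (\<lambda>(xs, i). rotate i xs) ({xs \<in> arrangements D. excursion xs} \<times> {..<size D})"
  by (rule inj_on_subset[OF inj_on_rotate_excursion[of "size D"]])
     (auto dest: length_finite_permutations_of_multiset)

text \<open>Rotation maps pairs of an excursion and a shift bijectively onto the
  arrangements.\<close>

lemma card_excursions:
  assumes D: "sum_mset D + 1 = size D"
  shows "size D * card {xs \<in> arrangements D. excursion xs} = card (arrangements D)"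
  by (subst (2) arrangements_conv_rotate_excursion[OF D],
      subst card_image[OF inj_on_rotate_excursion_arrangements])
     (simp add: card_cartesian_product mult.commute)

section \<open>Elementary symmetric polynomials\<close>

text \<open>The elementary symmetric polynomial of degree \<open>h\<close>, taken as a coefficient
  of the generating polynomial, so that evaluating the latter sums over all degrees.\<close>

definition esym :: "nat multiset \<Rightarrow> nat \<Rightarrow> real" where
  "esym E h = coeff (\<Prod>x\<in>#E. [:1, real x:]) h"

lemma esym_empty: "esym {#} h = (if h = 0 then 1 else 0)"
  by (cases h) (simp_all add: esym_def)

lemma esym_0: "esym E 0 = 1"
  by (induction E) (simp_all add: esym_def mult.commute[of _ "[:_, _:]"] coeff_mult)

lemma esym_add_mset: "esym (add_mset y E) (Suc h) = esym E (Suc h) + real y * esym E h"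
  by (simp add: esym_def)

lemma esym_nonneg: "esym E h \<ge> 0"
proof (induction E arbitrary: h)
  case empty then show ?case by (simp add: esym_empty)
next
  case (add y E) then show ?case by (cases h) (simp_all add: esym_0 esym_add_mset)
qed

text \<open>One factor can be taken out of a monomial of degree \<open>h + 1\<close> in
  \<open>h + 1\<close> ways. This matches the draw of the first entry of an arrangement.\<close>

lemma esym_Suc: "real (Suc h) * esym E (Suc h) = (\<Sum>x\<in>#E. real x * esym (E - {#x#}) h)"
proof (induction E arbitrary: h)
  case empty then show ?case by (simp add: esym_empty)
next
  case (add y E)
  have rm: "add_mset y E - {#x#} = add_mset y (E - {#x#})" if "x \<in># E" for x
    using that by simp
  show ?case
  proof (cases h)
    case 0
    then show ?thesis using add[of 0] by (simp add: esym_add_mset esym_0)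
  next
    case (Suc k)
    have "(\<Sum>x\<in>#add_mset y E. real x * esym (add_mset y E - {#x#}) h)
        = real y * esym E h + (\<Sum>x\<in>#E. real x * esym (add_mset y (E - {#x#})) h)"
      using rm by (simp cong: image_mset_cong)
    also have "(\<Sum>x\<in>#E. real x * esym (add_mset y (E - {#x#})) h)
        = (\<Sum>x\<in>#E. real x * esym (E - {#x#}) h + real y * (real x * esym (E - {#x#}) k))"
      unfolding Suc esym_add_mset by (simp add: algebra_simps)
    also have "\<dots> = (\<Sum>x\<in>#E. real x * esym (E - {#x#}) h)
        + real y * (\<Sum>x\<in>#E. real x * esym (E - {#x#}) k)"
      by (simp add: sum_mset.distrib sum_mset_distrib_left)
    also have "\<dots> = real (Suc h) * esym E (Suc h) + real y * (real (Suc k) * esym E (Suc k))"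
      using add by simp
    finally show ?thesis by (simp add: esym_add_mset Suc algebra_simps)
  qed
qed

text \<open>Drawing the first entry lowers \<open>h\<close> by one, through \<open>esym_Suc\<close>
  on the right and binomial absorption on the left. Without a quotient, the identity also covers
  \<open>h > size E\<close>, where both sides vanish.\<close>

lemma sum_prod_take_arrangements:
  "(\<Sum>xs\<in>arrangements E. real (prod_list (take h xs))) * real (size E choose h)
     = real (card (arrangements E)) * esym E h"
proof (induction h arbitrary: E)
  case 0 then show ?case by (simp add: esym_0)
next
  case (Suc h E)
  show ?case
  proof (cases "E = {#}")
    case True then show ?thesis by (simp add: esym_empty)
  next
    case False
    let ?m = "size E" and ?S = "\<lambda>h E. \<Sum>xs\<in>arrangements E. real (prod_list (take h xs))"
    have m: "?m > 0" using False by (simp add: nonempty_has_size)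
    have "real (Suc h) * real (?m choose Suc h) = real ?m * real ((?m - 1) choose h)"
      by (metis binomial_absorption of_nat_mult)
    then have "real (Suc h) * (?S (Suc h) E * real (?m choose Suc h))
        = ?S (Suc h) E * (real ?m * real ((?m - 1) choose h))"
      by (subst mult.left_commute) (simp only:)
    also have "\<dots> = (\<Sum>x\<in>set_mset E. real x * ?S h (E - {#x#})) * (real ?m * real ((?m - 1) choose h))"
      by (simp add: sum_arrangements_first[OF False] sum_distrib_left)
    also have "\<dots>
        = real ?m * (\<Sum>x\<in>set_mset E. real x * (?S h (E - {#x#}) * real ((?m - 1) choose h)))"
      by (simp add: sum_distrib_right sum_distrib_left mult_ac)
    also have "\<dots> = real ?m * (\<Sum>x\<in>set_mset E. real (card (arrangements (E - {#x#}))) *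
        (real x * esym (E - {#x#}) h))"
    proof (intro arg_cong[where f = "(*) (real ?m)"] sum.cong refl)
      fix x assume "x \<in> set_mset E"
      then have "size (E - {#x#}) = ?m - 1" by (simp add: size_Diff_singleton)
      with Suc[of "E - {#x#}"] show "real x * (?S h (E - {#x#}) * real ((?m - 1) choose h))
          = real (card (arrangements (E - {#x#}))) * (real x * esym (E - {#x#}) h)"
        by simp
    qed
    also have "\<dots> = real (card (arrangements E)) * (real (Suc h) * esym E (Suc h))"
      unfolding sum_card_arrangements_remove[OF False] esym_Suc using m by simp
    also have "\<dots> = real (Suc h) * (real (card (arrangements E)) * esym E (Suc h))"
      by (rule mult.left_commute)
    finally show ?thesis by (subst (asm) mult_cancel_left) simp
  qed
qed

text \<open>The right-hand side is the generating polynomial at \<open>\<theta>\<close>, and the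
  terms beyond \<open>h\<close> are nonnegative.\<close>

lemma sum_esym_le:
  assumes "\<theta> \<ge> 0"
  shows "(\<Sum>g\<le>h. esym E g * \<theta> ^ g) \<le> (\<Prod>x\<in>#E. 1 + \<theta> * real x)"
proof -
  let ?p = "\<Prod>x\<in>#E. [:1, real x:]"
  have "(\<Sum>g\<le>h. esym E g * \<theta> ^ g) \<le> (\<Sum>g\<le>max h (degree ?p). esym E g * \<theta> ^ g)"
    using assms by (intro sum_mono2) (auto simp: esym_nonneg)
  also have "\<dots> = (\<Sum>g\<le>degree ?p. esym E g * \<theta> ^ g)"
    by (rule sum.mono_neutral_right) (auto simp: esym_def coeff_eq_0)
  also have "\<dots> = poly ?p \<theta>" by (simp add: poly_altdef esym_def)
  also have "\<dots> = (\<Prod>x\<in>#E. 1 + \<theta> * real x)"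
    by (induction E) (simp_all add: algebra_simps)
  finally show ?thesis .
qed

text \<open>Markov's inequality for the binomial distribution with parameters \<open>n\<close> and \<open>\<theta> / (1 + \<theta>)\<close>.\<close>

lemma binomial_sum_atMost_ge:
  fixes \<theta> :: real
  assumes "\<theta> \<ge> 0" and h: "2 * real n * \<theta> \<le> real h"
  shows "(1 + \<theta>) ^ n \<le> 2 * (\<Sum>g\<le>h. real (n choose g) * \<theta> ^ g)"
proof (cases "h = 0 \<or> n = 0")
  case True
  then have "n = 0 \<or> \<theta> = 0" using assms by (auto simp: mult_le_0_iff)
  moreover have "(\<Sum>g\<le>h. real (n choose g) * \<theta> ^ g) \<ge> (\<Sum>g\<in>{0}. real (n choose g) * \<theta> ^ g)"
    using assms by (intro sum_mono2) auto
  ultimately show ?thesis by auto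
next
  case False
  have binom: "(1 + \<theta>) ^ k = (\<Sum>g\<le>k. real (k choose g) * \<theta> ^ g)" for k
    using binomial_ring[of \<theta> 1 k] by (simp add: add.commute)
  let ?b = "\<lambda>g. real (n choose g) * \<theta> ^ g"
  have b0: "?b g \<ge> 0" for g using assms by simp
  obtain m where m: "n = Suc m" using False by (cases n) auto
  \<comment> \<open>The mean of the binomial distribution, up to the normalising factor
    \<open>(1 + \<theta>) ^ n\<close>, computed by absorption.\<close>
  have "(\<Sum>g\<le>n. real g * ?b g) = (\<Sum>g\<le>m. real (Suc g) * ?b (Suc g))"
    unfolding m by (subst sum.atMost_Suc_shift) simp
  also have "\<dots> = (\<Sum>g\<le>m. real n * \<theta> * (real (m choose g) * \<theta> ^ g))"
  proof (rule sum.cong[OF refl])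
    fix g
    have "real (Suc g) * real (n choose Suc g) = real n * real (m choose g)"
      unfolding m by (metis Suc_times_binomial_eq mult.commute of_nat_mult)
    then show "real (Suc g) * ?b (Suc g) = real n * \<theta> * (real (m choose g) * \<theta> ^ g)"
      by (simp add: mult_ac del: of_nat_Suc)
  qed
  also have "\<dots> = real n * \<theta> * (1 + \<theta>) ^ m"
    by (simp add: sum_distrib_left[symmetric] binom)
  also have "\<dots> \<le> real h / 2 * (1 + \<theta>) ^ n"
  proof (rule mult_mono)
    show "(1 + \<theta>) ^ m \<le> (1 + \<theta>) ^ n" using assms by (intro power_increasing) (auto simp: m)
  qed (use assms in auto)
  finally have mean: "(\<Sum>g\<le>n. real g * ?b g) \<le> real h / 2 * (1 + \<theta>) ^ n" .
  have "real h * (\<Sum>g\<in>{..n} - {..h}. ?b g) \<le> (\<Sum>g\<in>{..n} - {..h}. real g * ?b g)"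
    unfolding sum_distrib_left using b0 by (intro sum_mono mult_right_mono) auto
  also have "\<dots> \<le> (\<Sum>g\<le>n. real g * ?b g)"
    using b0 by (intro sum_mono2) auto
  finally have "real h * (\<Sum>g\<in>{..n} - {..h}. ?b g) \<le> real h * ((1 + \<theta>) ^ n / 2)"
    using mean by simp
  then have tail: "(\<Sum>g\<in>{..n} - {..h}. ?b g) \<le> (1 + \<theta>) ^ n / 2" using False by simp
  have "(1 + \<theta>) ^ n = (\<Sum>g\<le>n. ?b g)" by (rule binom)
  also have "\<dots> = (\<Sum>g\<in>{..n} \<inter> {..h}. ?b g) + (\<Sum>g\<in>{..n} - {..h}. ?b g)"
    by (rule sum.Int_Diff) simp
  also have "\<dots> \<le> (\<Sum>g\<le>h. ?b g) + (1 + \<theta>) ^ n / 2"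
    using tail b0 by (intro add_mono sum_mono2) auto
  finally show ?thesis by simp
qed

section \<open>Comparing the generating polynomial with a power of
  \<open>1 + \<theta>\<close>\<close>

lemma one_plus_mult_le_power_exp:
  fixes \<theta> R :: real
  assumes l: "0 \<le> \<theta>" "\<theta> \<le> 1" and d: "d \<ge> 2" and R: "\<theta> * real d \<le> R"
  shows "1 + \<theta> * real d \<le> (1 + \<theta>) ^ d * exp (- (\<theta>\<^sup>2 * (real d)\<^sup>2 / (8 * (1 + R))))"
proof -
  define D where "D = real d"
  have D: "D \<ge> 2" using d by (simp add: D_def)
  \<comment> \<open>The logarithm of the quotient of the two sides at \<open>x\<close>, with
    \<open>D * x\<close> for \<open>R\<close>. It vanishes at 0 and is nondecreasing up to
    \<open>\<theta>\<close>: a quantitative Bernoulli inequality.\<close>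
  define F where "F x = D * ln (1 + x) - ln (1 + D * x) - D\<^sup>2 * x\<^sup>2 / (8 * (1 + D * x))" for x
  define F' where "F' x = D / (1 + x) - D / (1 + D * x)
      - (D\<^sup>2 * (2 * x) * (8 * (1 + D * x)) - D\<^sup>2 * x\<^sup>2 * (8 * D)) / (8 * (1 + D * x))\<^sup>2" for x
  have "F 0 \<le> F \<theta>"
  proof (rule DERIV_nonneg_imp_nondecreasing[OF l(1)])
    fix x assume x: "0 \<le> x" "x \<le> \<theta>"
    have pos: "1 + D * x > 0" "1 + x > 0" using x D by (auto intro: add_pos_nonneg)
    have "(F has_real_derivative F' x) (at x)"
      unfolding F_def F'_def using pos x D
      by (auto intro!: derivative_eq_intros simp: power2_eq_square)
    moreover have "F' x \<ge> 0"
    proof -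
      define y where "y = 1 + D * x"
      have y: "y > 0" "y \<ge> 1" "D * x = y - 1" using pos x D by (auto simp: y_def)
      \<comment> \<open>The second part of the quotient rule is dropped. What remains reduces to
        \<open>D * (1 + x) \<le> 4 * (D - 1)\<close>, which holds since \<open>x \<le> 1\<close> and
        \<open>D \<ge> 2\<close>; the constant 8 is made for this.\<close>
      have "(D\<^sup>2 * (2 * x) * (8 * y) - D\<^sup>2 * x\<^sup>2 * (8 * D)) / (8 * y)\<^sup>2
          \<le> (D\<^sup>2 * (2 * x) * (8 * y)) / (8 * y)\<^sup>2"
        using x D by (intro divide_right_mono) auto
      also have "\<dots> = D\<^sup>2 * x / (4 * y)" using y by (simp add: power2_eq_square field_simps)
      also have "\<dots> \<le> D * (D - 1) * x / ((1 + x) * y)"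
      proof -
        have "D * (1 + x) \<le> 4 * (D - 1)"
        proof -
          have "D * (1 + x) \<le> D * 2" using x l(2) D by (intro mult_left_mono) auto
          also have "\<dots> \<le> 4 * (D - 1)" using D by simp
          finally show ?thesis .
        qed
        then have "D / 4 \<le> (D - 1) / (1 + x)" using pos by (simp add: field_simps)
        then have "D * x / y * (D / 4) \<le> D * x / y * ((D - 1) / (1 + x))"
          using x D y by (intro mult_left_mono) auto
        then show ?thesis by (simp add: power2_eq_square mult_ac)
      qed
      also have "\<dots> = D / (1 + x) - D / y"
      proof -
        have "D * (D - 1) * x = D * y - D * (1 + x)" by (simp add: y_def algebra_simps)
        then show ?thesis using y(1) pos(2) by (simp add: diff_frac_eq)
      qed
      finally show ?thesis unfolding F'_def y_def by simp
    qed
    ultimately show "\<exists>y. (F has_real_derivative y) (at x) \<and> 0 \<le> y" by blast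
  qed
  then have F0: "F \<theta> \<ge> 0" by (simp add: F_def)
  have pos: "1 + D * \<theta> > 0" "1 + \<theta> > 0" using l D by (auto intro: add_pos_nonneg)
  have "D\<^sup>2 * \<theta>\<^sup>2 / (8 * (1 + R)) \<le> D\<^sup>2 * \<theta>\<^sup>2 / (8 * (1 + D * \<theta>))"
    using R pos l D by (intro divide_left_mono mult_pos_pos) (auto simp: D_def mult.commute)
  then have "ln (1 + D * \<theta>) \<le> D * ln (1 + \<theta>) - D\<^sup>2 * \<theta>\<^sup>2 / (8 * (1 + R))"
    using F0 by (simp add: F_def)
  then have "exp (ln (1 + D * \<theta>)) \<le> exp (D * ln (1 + \<theta>) - D\<^sup>2 * \<theta>\<^sup>2 / (8 * (1 + R)))"
    by simp
  also have "\<dots> = (1 + \<theta>) ^ d * exp (- (D\<^sup>2 * \<theta>\<^sup>2 / (8 * (1 + R))))"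
    using pos by (simp add: exp_diff exp_minus D_def exp_of_nat_mult divide_inverse)
  finally show ?thesis using pos by (simp add: D_def mult.commute)
qed

text \<open>For \<open>x = 0\<close> and \<open>x = 1\<close> the factor equals
  \<open>(1 + \<theta>) ^ x\<close>, so only larger entries gain. The common bound \<open>R\<close>
  gives all exponents the same denominator.\<close>

lemma prod_one_plus_le_aux:
  fixes \<theta> R :: real
  assumes l: "0 \<le> \<theta>" "\<theta> \<le> 1" and R: "\<forall>x\<in>#D. x \<ge> 2 \<longrightarrow> \<theta> * real x \<le> R"
  shows "(\<Prod>x\<in>#D. 1 + \<theta> * real x) \<le> (1 + \<theta>) ^ sum_mset D *
     exp (- (\<theta>\<^sup>2 * (\<Sum>x\<in>#D. if x \<ge> 2 then (real x)\<^sup>2 else 0) / (8 * (1 + R))))"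
  using R
proof (induction D)
  case empty then show ?case by simp
next
  case (add y D)
  let ?c = "\<lambda>x::nat. if x \<ge> 2 then (real x)\<^sup>2 else 0"
  have y: "1 + \<theta> * real y \<le> (1 + \<theta>) ^ y * exp (- (\<theta>\<^sup>2 * ?c y / (8 * (1 + R))))"
  proof (cases "y \<ge> 2")
    case True
    then show ?thesis using one_plus_mult_le_power_exp[OF l True, of R] add.prems by simp
  next
    case False
    then have "y = 0 \<or> y = 1" by auto
    then show ?thesis by auto
  qed
  have nonneg: "(\<Prod>x\<in>#D. 1 + \<theta> * real x) \<ge> 0" using l by (induction D) auto
  have "(\<Prod>x\<in>#add_mset y D. 1 + \<theta> * real x)
      \<le> ((1 + \<theta>) ^ y * exp (- (\<theta>\<^sup>2 * ?c y / (8 * (1 + R))))) *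
         ((1 + \<theta>) ^ sum_mset D * exp (- (\<theta>\<^sup>2 * (\<Sum>x\<in>#D. ?c x) / (8 * (1 + R)))))"
    unfolding image_mset_add_mset prod_mset.add_mset
    using l add.prems
    by (intro mult_mono y add.IH) (auto intro!: mult_nonneg_nonneg nonneg)
  also have "\<dots> = (1 + \<theta>) ^ sum_mset (add_mset y D) *
      exp (- (\<theta>\<^sup>2 * (\<Sum>x\<in>#add_mset y D. ?c x) / (8 * (1 + R))))"
    by (simp add: power_add exp_add[symmetric] distrib_left add_divide_distrib)
  finally show ?case .
qed

text \<open>Let \<open>C\<close> be the sum of the squares of the entries at least 2. Each of these
  is at most \<open>sqrt C\<close>, so \<open>R = \<theta> * sqrt C\<close> is admissible, and
  \<open>R\<^sup>2 / (1 + R) \<ge> R - 1\<close>. Moreover \<open>C\<close> dominates the sum of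
  \<open>(x - 1)\<^sup>2\<close>.\<close>

lemma prod_one_plus_le:
  fixes \<theta> :: real
  assumes l: "0 \<le> \<theta>" "\<theta> \<le> 1" and D: "sum_mset D + 1 = size D" and big: "\<exists>x\<in>#D. x \<ge> 2"
  shows "(\<Prod>x\<in>#D. 1 + \<theta> * real x)
     \<le> (1 + \<theta>) ^ size D * exp (- ((\<theta> * sqrt (\<Sum>x\<in>#D. (real x - 1)\<^sup>2) - 1) / 8))"
proof -
  let ?c = "\<lambda>x::nat. if x \<ge> 2 then (real x)\<^sup>2 else 0"
  define C where "C = (\<Sum>x\<in>#D. ?c x)"
  define q where "q = (\<Sum>x\<in>#D. (real x - 1)\<^sup>2)"
  define R where "R = \<theta> * sqrt C"
  have sum: "(\<Sum>x\<in>#D. real x) + 1 = real (size D)"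
  proof -
    have "(\<Sum>x\<in>#D. real x) = real (sum_mset D)" by (induction D) auto
    then show ?thesis using D using arg_cong[OF D, of real] by simp
  qed
  obtain z where z: "z \<in># D" "z \<ge> 2" using big by blast
  \<comment> \<open>Subtracting \<open>1 - x\<close>, which sums to 1, cancels the contribution of
    the zeros, so only entries at least 2 remain. The loss of 1 is recovered at the entry
    \<open>z\<close>, where \<open>z\<^sup>2 - z \<le> z\<^sup>2 - 1\<close>.\<close>
  have "q - 1 = (\<Sum>x\<in>#D. (real x - 1)\<^sup>2 - (1 - real x))"
  proof -
    have "(\<Sum>x\<in>#D. (real x - 1)\<^sup>2 - (1 - real x)) = (\<Sum>x\<in>#D. (real x - 1)\<^sup>2) + (\<Sum>x\<in>#D. real x) - size D"
      by (induction D) auto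
    then show ?thesis using sum by (simp add: q_def)
  qed
  also have "\<dots> \<le> C - 1"
  proof -
    let ?f = "\<lambda>x. (real x - 1)\<^sup>2 - (1 - real x)"
    have le: "?f x \<le> ?c x" for x
    proof (cases "x \<ge> 2")
      case True then show ?thesis by (simp add: power2_eq_square algebra_simps)
    next
      case False
      then have "x = 0 \<or> x = 1" by auto
      then show ?thesis by auto
    qed
    have "(\<Sum>x\<in>#D. ?f x) = ?f z + (\<Sum>x\<in>#D - {#z#}. ?f x)"
      using sum_mset_remove1[OF z(1), of ?f] by simp
    also have "\<dots> \<le> (?c z - 1) + (\<Sum>x\<in>#D - {#z#}. ?c x)"
      using z(2) le by (intro add_mono sum_mset_mono) (auto simp: power2_eq_square algebra_simps)
    also have "\<dots> = C - 1" using sum_mset_remove1[OF z(1), of ?c] by (simp add: C_def)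
    finally show ?thesis .
  qed
  finally have qC: "q \<le> C" by simp
  have c_le: "?c x \<le> C" if "x \<in># D" for x
  proof -
    have "0 \<le> (\<Sum>x\<in>#D - {#x#}. ?c x)"
      unfolding sum_mset_conv_sum_set by (intro sum_nonneg) auto
    then show ?thesis using sum_mset_remove1[OF that, of ?c] by (simp add: C_def)
  qed
  have C0: "C \<ge> 0" using c_le[OF z(1)] by (auto split: if_splits intro: order.trans[OF zero_le_power2])
  have R_ge: "\<theta> * real x \<le> R" if "x \<in># D" "x \<ge> 2" for x
    unfolding R_def using l c_le[OF that(1)] that(2) by (intro mult_left_mono real_le_rsqrt) auto
  have R0: "R \<ge> 0" using l C0 by (simp add: R_def)
  have "(\<Prod>x\<in>#D. 1 + \<theta> * real x) \<le> (1 + \<theta>) ^ sum_mset D * exp (- (\<theta>\<^sup>2 * C / (8 * (1 + R))))"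
    unfolding C_def by (rule prod_one_plus_le_aux) (use l R_ge in auto)
  also have "\<dots> \<le> (1 + \<theta>) ^ size D * exp (- ((\<theta> * sqrt q - 1) / 8))"
  proof (rule mult_mono)
    show "(1 + \<theta>) ^ sum_mset D \<le> (1 + \<theta>) ^ size D"
      using l D by (intro power_increasing) auto
    have "\<theta> * sqrt q - 1 \<le> R - 1"
      unfolding R_def using l qC by (simp add: mult_left_mono)
    also have "\<dots> \<le> R\<^sup>2 / (1 + R)" using R0 by (simp add: field_simps power2_eq_square)
    also have "R\<^sup>2 = \<theta>\<^sup>2 * C" using C0 by (simp add: R_def power_mult_distrib)
    finally show "exp (- (\<theta>\<^sup>2 * C / (8 * (1 + R)))) \<le> exp (- ((\<theta> * sqrt q - 1) / 8))"
      using R0 by (simp add: field_simps)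
  qed (use l in auto)
  finally show ?thesis unfolding q_def .
qed

section \<open>Finite plane trees\<close>

text \<open>A datatype allows structural recursion; \<open>verts\<close> maps it bijectively onto
  the finite Ulam-Harris trees.\<close>

datatype ptree = Node (kids: "ptree list")

fun degs :: "ptree \<Rightarrow> nat multiset" where
  "degs (Node ts) = add_mset (length ts) (\<Sum>t\<leftarrow>ts. degs t)"

primrec level_size :: "nat \<Rightarrow> ptree \<Rightarrow> nat" where
  "level_size 0 t = 1"
| "level_size (Suc h) t = (\<Sum>u\<leftarrow>kids t. level_size h u)"

primrec vertex :: "nat list \<Rightarrow> ptree \<Rightarrow> bool" where
  "vertex [] t = True"
| "vertex (i # v) t = (i < length (kids t) \<and> vertex v (kids t ! i))"

definition verts :: "ptree \<Rightarrow> nat list set" where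
  "verts t = {v. vertex v t}"

lemma verts_eq:
  "verts t = insert [] (\<Union>i<length (kids t). (#) i ` verts (kids t ! i))"
proof -
  have "v \<in> verts t \<longleftrightarrow> v \<in> insert [] (\<Union>i<length (kids t). (#) i ` verts (kids t ! i))" for v
    by (cases v) (auto simp: verts_def)
  then show ?thesis by blast
qed

lemma Nil_in_verts: "[] \<in> verts t"
  by (simp add: verts_def)

lemma vertex_appendD: "vertex (u @ v) t \<Longrightarrow> vertex u t"
  by (induction u arbitrary: t) auto

lemma plane_tree_verts: "plane_tree (verts t)"
proof -
  have "\<exists>m. \<forall>i. vertex (u @ [i]) t \<longleftrightarrow> i < m" if "vertex u t" for u
    using that by (induction u arbitrary: t) auto
  then show ?thesis
    unfolding plane_tree_def verts_def by (auto dest: vertex_appendD)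
qed

lemma finite_verts: "finite (verts t)"
  by (induction t) (subst verts_eq, auto)

lemma sum_verts:
  fixes f :: "nat list \<Rightarrow> 'a :: comm_monoid_add"
  shows "(\<Sum>v\<in>verts t. f v) = f [] + (\<Sum>i<length (kids t). \<Sum>v\<in>verts (kids t ! i). f (i # v))"
proof -
  have "(\<Sum>v\<in>verts t. f v) = f [] + (\<Sum>v\<in>(\<Union>i<length (kids t). (#) i ` verts (kids t ! i)). f v)"
    by (subst verts_eq, subst sum.insert) (auto simp: finite_verts)
  also have "(\<Sum>v\<in>(\<Union>i<length (kids t). (#) i ` verts (kids t ! i)). f v)
      = (\<Sum>i<length (kids t). \<Sum>v\<in>(#) i ` verts (kids t ! i). f v)"
    by (rule sum.UNION_disjoint) (auto simp: finite_verts)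
  also have "\<dots> = (\<Sum>i<length (kids t). \<Sum>v\<in>verts (kids t ! i). f (i # v))"
    by (simp add: sum.reindex)
  finally show ?thesis .
qed

lemma num_children_verts_Nil: "num_children (verts t) [] = length (kids t)"
  by (simp add: num_children_def verts_def)

lemma num_children_verts_Cons:
  "i < length (kids t) \<Longrightarrow> num_children (verts t) (i # v) = num_children (verts (kids t ! i)) v"
  by (simp add: num_children_def verts_def)

lemma sum_list_conv_sum_lessThan:
  fixes f :: "'b \<Rightarrow> 'a :: comm_monoid_add"
  shows "(\<Sum>x\<leftarrow>xs. f x) = (\<Sum>i<length xs. f (xs ! i))"
  by (simp add: sum_list_sum_nth atLeast0LessThan)

text \<open>A sum of singletons instead of an image, so that the splitting \<open>sum_verts\<close>
  into root and subtrees applies.\<close>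

lemma sum_num_children_verts: "(\<Sum>v\<in>verts t. {#num_children (verts t) v#}) = degs t"
proof (induction t)
  case (Node ts)
  let ?t = "Node ts"
  have "(\<Sum>v\<in>verts ?t. {#num_children (verts ?t) v#})
      = {#length ts#} + (\<Sum>i<length ts. \<Sum>v\<in>verts (ts ! i). {#num_children (verts ?t) (i # v)#})"
    by (subst sum_verts) (simp add: num_children_verts_Nil)
  also have "(\<Sum>i<length ts. \<Sum>v\<in>verts (ts ! i). {#num_children (verts ?t) (i # v)#})
      = (\<Sum>i<length ts. degs (ts ! i))"
    by (intro sum.cong refl) (simp add: num_children_verts_Cons Node)
  finally show ?case by (simp add: sum_list_conv_sum_lessThan)
qed

lemma image_mset_num_children_verts:
  "image_mset (num_children (verts t)) (mset_set (verts t)) = degs t"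
proof -
  have "image_mset f (mset_set A) = (\<Sum>v\<in>A. {#f v#})" if "finite A" for A and f :: "nat list \<Rightarrow> nat"
    using that by (induction A rule: finite_induct) auto
  from this[OF finite_verts] show ?thesis using sum_num_children_verts by simp
qed

lemma card_verts: "card (verts t) = size (degs t)"
  by (simp flip: image_mset_num_children_verts)

lemma prod_num_children_verts: "(\<Prod>v\<in>verts t. f (num_children (verts t) v)) = (\<Prod>k\<in>#degs t. f k)"
  unfolding image_mset_num_children_verts[symmetric] prod_unfold_prod_mset
  by (simp add: multiset.map_comp comp_def)

lemma level_size_eq_card: "level_size h t = card {v \<in> verts t. length v = h}"
proof (induction h arbitrary: t)
  case 0
  have "{v \<in> verts t. length v = 0} = {[]}" by (auto simp: verts_def)
  then show ?case by simp
next
  case (Suc h)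
  have card: "card {v \<in> verts t. P v} = (\<Sum>v\<in>verts t. if P v then 1 else 0)" for t P
    using finite_verts by (simp add: sum.If_cases Int_def)
  show ?case
    by (simp only: card) (subst sum_verts, simp add: Suc card sum_list_conv_sum_lessThan)
qed

lemma inj_verts: "inj verts"
proof (rule injI)
  fix t t' assume "verts t = verts t'"
  then show "t = t'"
  proof (induction t arbitrary: t')
    case (Node ts)
    obtain us where t': "t' = Node us" by (cases t')
    have len: "length ts = length us"
      using num_children_verts_Nil[of "Node ts"] num_children_verts_Nil[of t'] Node.prems t' by simp
    have "ts ! i = us ! i" if i: "i < length ts" for i
    proof (rule Node.IH)
      show "ts ! i \<in> set ts" using i by simp
      have "v \<in> verts (ts ! i) \<longleftrightarrow> i # v \<in> verts (Node ts)" for v using i by (simp add: verts_def)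
      moreover have "v \<in> verts (us ! i) \<longleftrightarrow> i # v \<in> verts t'" for v
        using i len t' by (simp add: verts_def)
      ultimately show "verts (ts ! i) = verts (us ! i)" using Node.prems by blast
    qed
    then show ?case using len t' by (simp add: list_eq_iff_nth_eq)
  qed
qed

text \<open>Induction on the cardinality: the words \<open>v\<close> with \<open>i # v\<close> in
  \<open>A\<close> form a smaller plane tree, which becomes the child number
  \<open>i\<close>.\<close>

lemma verts_surj:
  assumes "plane_tree A" "finite A"
  shows "\<exists>t. verts t = A"
  using assms
proof (induction "card A" arbitrary: A rule: less_induct)
  case (less A)
  define sub where "sub i = {v. i # v \<in> A}" for i
  have Nil: "[] \<in> A" using less.prems by (simp add: plane_tree_def)
  obtain m where m: "\<And>i. [i] \<in> A \<longleftrightarrow> i < m"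
  proof -
    have "\<exists>m. \<forall>i. [] @ [i] \<in> A \<longleftrightarrow> i < m"
      using less.prems(1) Nil unfolding plane_tree_def by blast
    then show ?thesis using that by auto
  qed
  have prefix: "u @ v \<in> A \<Longrightarrow> u \<in> A" for u v
  proof (induction v rule: rev_induct)
    case (snoc x v)
    then have "(u @ v) @ [x] \<in> A" by simp
    then have "u @ v \<in> A" using less.prems(1) unfolding plane_tree_def by blast
    then show ?case by (rule snoc.IH)
  qed simp
  have ex: "\<exists>t. verts t = sub i" if "i < m" for i
  proof (rule less.hyps)
    have fin: "finite ((#) i ` sub i)" by (rule finite_subset[OF _ less.prems(2)]) (auto simp: sub_def)
    then show "finite (sub i)" by (rule finite_imageD) simp
    have "card (sub i) = card ((#) i ` sub i)" by (simp add: card_image)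
    also have "\<dots> < card A"
      using less.prems(2) Nil by (intro psubset_card_mono) (auto simp: sub_def)
    finally show "card (sub i) < card A" .
    show "plane_tree (sub i)"
      unfolding plane_tree_def
    proof (intro conjI allI impI ballI)
      show "[] \<in> sub i" using that m by (simp add: sub_def)
      show "u @ [j] \<in> sub i \<Longrightarrow> u \<in> sub i" for u j
        unfolding sub_def mem_Collect_eq by (rule prefix[of "i # u" "[j]"]) simp
      show "\<exists>k. \<forall>j. (u @ [j] \<in> sub i) = (j < k)" if "u \<in> sub i" for u
      proof -
        have "i # u \<in> A" using that by (simp add: sub_def)
        then obtain k where "\<forall>j. (i # u) @ [j] \<in> A \<longleftrightarrow> j < k"
          using less.prems(1) unfolding plane_tree_def by blast
        then have "\<forall>j. (u @ [j] \<in> sub i) = (j < k)" by (simp add: sub_def)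
        then show ?thesis by (rule exI)
      qed
    qed
  qed
  define T where "T i = (SOME t. verts t = sub i)" for i
  have T: "verts (T i) = sub i" if "i < m" for i
    unfolding T_def by (rule someI_ex[OF ex[OF that]])
  have "v \<in> verts (Node (map T [0..<m])) \<longleftrightarrow> v \<in> A" for v
  proof (cases v)
    case Nil then show ?thesis using \<open>[] \<in> A\<close> by (simp add: verts_def)
  next
    case (Cons i u)
    have "i < m" if "i # u \<in> A" using prefix[of "[i]" u] m that by simp
    moreover have "vertex u (T i) \<longleftrightarrow> i # u \<in> A" if "i < m"
    proof -
      have "u \<in> verts (T i) \<longleftrightarrow> u \<in> sub i" by (simp only: T[OF that])
      then show ?thesis by (simp add: verts_def sub_def)
    qed
    ultimately show ?thesis unfolding Cons verts_def by auto
  qed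
  then show ?case by blast
qed

section \<open>Width and height through level sizes\<close>

lemma level_size_le: "level_size h t \<le> size (degs t)"
  unfolding level_size_eq_card card_verts[symmetric] by (rule card_mono[OF finite_verts]) auto

lemma Wd_verts: "\<exists>h. Wd (verts t) = level_size h t"
proof -
  have "range (\<lambda>h. level_size h t) \<subseteq> {..size (degs t)}" using level_size_le by auto
  then have "finite (range (\<lambda>h. level_size h t))" using finite_subset by blast
  then have "Max (range (\<lambda>h. level_size h t)) \<in> range (\<lambda>h. level_size h t)" by (rule Max_in) simp
  then show ?thesis unfolding Wd_def level_size_eq_card by blast
qed

text \<open>The prefix of length \<open>h\<close> of a deepest vertex is again a vertex.\<close>

lemma level_size_pos:
  assumes "h \<le> Ht (verts t)"
  shows "level_size h t \<ge> 1"
proof -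
  have "Max (length ` verts t) \<in> length ` verts t"
    using finite_verts[of t] Nil_in_verts[of t] by (intro Max_in) auto
  then obtain v where v: "vertex v t" "length v = Ht (verts t)" by (auto simp: Ht_def verts_def)
  have "vertex (take h v) t" by (rule vertex_appendD[of _ "drop h v"]) (simp add: v)
  then have "take h v \<in> {v \<in> verts t. length v = h}" using v assms by (simp add: verts_def)
  then have "card {v \<in> verts t. length v = h} > 0"
    using finite_verts[of t] by (subst card_gt_0_iff) auto
  then show ?thesis by (simp add: level_size_eq_card)
qed

lemma Ht_verts_less: "Ht (verts t) < size (degs t)"
proof -
  let ?H = "Ht (verts t)"
  have "{..?H} \<subseteq> length ` verts t"
  proof
    fix h assume "h \<in> {..?H}"
    then have "card {v \<in> verts t. length v = h} \<ge> 1" using level_size_pos by (simp add: level_size_eq_card)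
    then have "{v \<in> verts t. length v = h} \<noteq> {}" by (metis card.empty not_one_le_zero)
    then show "h \<in> length ` verts t" by auto
  qed
  then have "card {..?H} \<le> card (length ` verts t)"
    by (intro card_mono finite_imageI finite_verts)
  also have "\<dots> \<le> card (verts t)" by (rule card_image_le[OF finite_verts])
  finally have "card {..?H} \<le> card (verts t)" .
  then show ?thesis by (simp add: card_verts)
qed

section \<open>Breadth-first coding and forests\<close>

abbreviation forest_degs :: "ptree list \<Rightarrow> nat multiset" where
  "forest_degs ts \<equiv> (\<Sum>t\<leftarrow>ts. degs t)"

lemma forest_degs_Cons: "forest_degs (t # ts) = add_mset (length (kids t)) (forest_degs (ts @ kids t))"
  by (cases t) (simp add: union_commute)

text \<open>The list is the queue of a breadth-first search: its first tree is removed and the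
  children of that tree join the end, so the number of vertices drops by one.\<close>

function bfs :: "ptree list \<Rightarrow> nat list" where
  "bfs [] = []"
| "bfs (t # ts) = length (kids t) # bfs (ts @ kids t)"
  by pat_completeness auto
termination
  by (relation "Wellfounded.measure (\<lambda>ts. size (forest_degs ts))") (simp_all only: forest_degs_Cons in_measure size_add_mset wf_measure lessI)

lemma mset_bfs: "mset (bfs ts) = forest_degs ts"
proof (induction ts rule: bfs.induct)
  case (2 t ts)
  show ?case unfolding forest_degs_Cons bfs.simps mset.simps 2 ..
qed simp

text \<open>Excursions from a general starting value: a queue of initial length \<open>r\<close>
  that first becomes empty when \<open>xs\<close> is used up. Induction along the path needs a
  variable \<open>r\<close>.\<close>

definition queue_path :: "nat \<Rightarrow> nat list \<Rightarrow> bool" where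
  "queue_path r xs \<longleftrightarrow> sum_list xs + r = length xs \<and> (\<forall>j<length xs. j < r + sum_list (take j xs))"

lemma queue_path_Nil: "queue_path r [] \<longleftrightarrow> r = 0"
  by (simp add: queue_path_def)

lemma queue_path_Cons: "queue_path r (x # xs) \<longleftrightarrow> r > 0 \<and> queue_path (r - 1 + x) xs"
proof (cases r)
  case (Suc k)
  have "(\<forall>j<Suc (length xs). j < Suc k + sum_list (take j (x # xs)))
      \<longleftrightarrow> (\<forall>j<length xs. Suc j < Suc k + sum_list (take (Suc j) (x # xs)))"
    unfolding All_less_Suc2 by simp
  then show ?thesis by (simp add: queue_path_def Suc add_ac)
qed (auto simp: queue_path_def)

lemma excursion_iff_queue_path: "excursion xs \<longleftrightarrow> queue_path 1 xs"
  by (simp add: excursion_def queue_path_def less_Suc_eq_le)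

lemma queue_path_bfs: "queue_path (length ts) (bfs ts)"
  by (induction ts rule: bfs.induct) (simp_all add: queue_path_Nil queue_path_Cons)

text \<open>Decoding from the back: the last \<open>x\<close> trees of the forest coded by
  \<open>xs\<close> are the children of the first tree and are put under a new root.\<close>

lemma bfs_surj: "queue_path r xs \<Longrightarrow> \<exists>ts. length ts = r \<and> bfs ts = xs"
proof (induction xs arbitrary: r)
  case Nil then show ?case by (simp add: queue_path_Nil)
next
  case (Cons x xs)
  then obtain fs where fs: "length fs = r - 1 + x" "bfs fs = xs" and r: "r > 0"
    unfolding queue_path_Cons by blast
  then have "length (Node (drop (r - 1) fs) # take (r - 1) fs) = r"
    "bfs (Node (drop (r - 1) fs) # take (r - 1) fs) = x # xs" by simp_all
  then show ?case by blast
qed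

lemma bfs_inj: "length ts = length us \<Longrightarrow> bfs ts = bfs us \<Longrightarrow> ts = us"
proof (induction ts arbitrary: us rule: bfs.induct)
  case 1 then show ?case by simp
next
  case (2 t ts)
  then obtain u us' where us: "us = u # us'" by (cases us) auto
  with 2 have len: "length ts = length us'" "length (kids t) = length (kids u)" by auto
  have "ts @ kids t = us' @ kids u" by (rule "2.IH") (use 2 us len in auto)
  then have "ts = us'" "kids t = kids u" using len by auto
  then show ?case using us by (simp add: ptree.expand)
qed

section \<open>Forests and trees with prescribed offspring numbers\<close>

definition forests_with :: "nat \<Rightarrow> nat multiset \<Rightarrow> ptree list set" where
  "forests_with r D = {ts. length ts = r \<and> forest_degs ts = D}"

definition trees_with :: "nat multiset \<Rightarrow> ptree set" where
  "trees_with D = {t. degs t = D}"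

lemma inj_on_bfs_forests: "inj_on bfs (forests_with r D)"
  by (rule inj_onI) (auto simp: forests_with_def intro: bfs_inj)

lemma bfs_forests_subset: "bfs ` forests_with r D \<subseteq> arrangements D"
  by (auto simp: forests_with_def permutations_of_multiset_def mset_bfs)

lemma finite_forests: "finite (forests_with r D)"
  by (rule finite_imageD[OF finite_subset[OF bfs_forests_subset] inj_on_bfs_forests]) simp

lemma card_forests_le: "card (forests_with r D) \<le> card (arrangements D)"
  by (rule card_inj_on_le[OF inj_on_bfs_forests bfs_forests_subset]) simp

lemma forests_1: "forests_with 1 D = (\<lambda>t. [t]) ` trees_with D"
  by (auto simp: forests_with_def trees_with_def length_Suc_conv)

lemma finite_trees: "finite (trees_with D)"
  using finite_forests[of 1 D] unfolding forests_1 by (rule finite_imageD) (simp add: inj_on_def)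

lemma bij_betw_bfs_trees: "bij_betw (\<lambda>t. bfs [t]) (trees_with D) {xs \<in> arrangements D. excursion xs}"
proof (rule bij_betwI')
  show "(bfs [t] = bfs [u]) = (t = u)" for t u
    using bfs_inj[of "[t]" "[u]"] by auto
  show "bfs [t] \<in> {xs \<in> arrangements D. excursion xs}" if "t \<in> trees_with D" for t
    using that mset_bfs[of "[t]"] queue_path_bfs[of "[t]"]
    by (simp add: trees_with_def permutations_of_multiset_def excursion_iff_queue_path del: bfs.simps)
next
  fix xs assume xs: "xs \<in> {xs \<in> arrangements D. excursion xs}"
  then obtain ts where ts: "length ts = 1" "bfs ts = xs"
    using bfs_surj[of 1 xs] by (auto simp: excursion_iff_queue_path)
  then obtain t where t: "ts = [t]" by (auto simp: length_Suc_conv)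
  have "degs t = D"
    using mset_bfs[of ts] ts xs t by (simp add: permutations_of_multiset_def del: bfs.simps)
  then show "\<exists>t\<in>trees_with D. xs = bfs [t]" using ts t by (auto simp: trees_with_def)
qed

lemma card_trees:
  assumes "sum_mset D + 1 = size D"
  shows "size D * card (trees_with D) = card (arrangements D)"
  using card_excursions[OF assms] bij_betw_same_card[OF bij_betw_bfs_trees[of D]] by simp

text \<open>Removing the root of the first tree leaves its \<open>k\<close> subtrees followed by the
  other trees. The subtrees stay in front, so \<open>k\<close> and the new forest determine the old
  one.\<close>

lemma sum_forests_first:
  assumes "r > 0"
  shows "(\<Sum>ts\<in>forests_with r D. F ts) = (\<Sum>k\<in>set_mset D. \<Sum>fs\<in>forests_with (r - 1 + k) (D - {#k#}).
     F (Node (take k fs) # drop k fs))"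
proof -
  have forest_degs_split: "forest_degs (take k fs) + forest_degs (drop k fs) = forest_degs fs" for k and fs :: "ptree list"
    by (metis append_take_drop_id map_append sum_list_append)
  have "(\<Sum>k\<in>set_mset D. \<Sum>fs\<in>forests_with (r - 1 + k) (D - {#k#}). F (Node (take k fs) # drop k fs))
      = (\<Sum>(k, fs)\<in>(SIGMA k:set_mset D. forests_with (r - 1 + k) (D - {#k#})). F (Node (take k fs) # drop k fs))"
    by (rule sum.Sigma) (auto simp: finite_forests)
  also have "\<dots> = (\<Sum>ts\<in>forests_with r D. F ts)"
  proof (rule sum.reindex_bij_witness[of _
      "\<lambda>ts. (length (kids (hd ts)), kids (hd ts) @ tl ts)" "\<lambda>(k, fs). Node (take k fs) # drop k fs"])
    fix p assume p: "p \<in> (SIGMA k:set_mset D. forests_with (r - 1 + k) (D - {#k#}))"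
    obtain k fs where kfs: "p = (k, fs)" "k \<in># D" "length fs = r - 1 + k" "forest_degs fs = D - {#k#}"
      using p by (auto simp: forests_with_def)
    show "(\<lambda>ts. (length (kids (hd ts)), kids (hd ts) @ tl ts)) ((\<lambda>(k, fs). Node (take k fs) # drop k fs) p) = p"
      using kfs by simp
    have "forest_degs (Node (take k fs) # drop k fs) = add_mset k (forest_degs fs)"
      using kfs(3) forest_degs_split[of k fs] by simp
    then show "(\<lambda>(k, fs). Node (take k fs) # drop k fs) p \<in> forests_with r D"
      using kfs assms by (simp add: forests_with_def)
  next
    fix ts assume ts: "ts \<in> forests_with r D"
    then obtain t us where tus: "ts = t # us" using assms by (cases ts) (auto simp: forests_with_def)
    have "forest_degs ts = add_mset (length (kids t)) (forest_degs (kids t @ us))"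
      unfolding tus forest_degs_Cons by (simp add: union_commute)
    then show "(length (kids (hd ts)), kids (hd ts) @ tl ts) \<in> (SIGMA k:set_mset D. forests_with (r - 1 + k) (D - {#k#}))"
      using ts tus by (auto simp: forests_with_def)
    show "(\<lambda>(k, fs). Node (take k fs) # drop k fs) (length (kids (hd ts)), kids (hd ts) @ tl ts) = ts"
      by (simp add: tus)
  qed auto
  finally show ?thesis by simp
qed

text \<open>Exchanging the trees at positions 0 and \<open>i\<close> is an involution on the
  forests.\<close>

lemma sum_forests_swap:
  assumes "i < r"
  shows "(\<Sum>ts\<in>forests_with r D. g (ts ! i)) = (\<Sum>ts\<in>forests_with r D. g (ts ! 0))"
proof -
  define sw where "sw ts = (ts[0 := ts ! i])[i := ts ! 0]" for ts :: "ptree list"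
  have inv: "sw (sw ts) = ts" if "length ts = r" for ts
    using that assms by (auto simp: sw_def list_eq_iff_nth_eq nth_list_update)
  have sw: "sw ts \<in> forests_with r D" if "ts \<in> forests_with r D" for ts
  proof -
    have "mset (sw ts) = mset ts"
      unfolding sw_def using that assms by (intro mset_swap) (auto simp: forests_with_def)
    then have "forest_degs (sw ts) = forest_degs ts" by (metis mset_map sum_mset_sum_list)
    then show ?thesis using that by (simp add: forests_with_def sw_def)
  qed
  have nth: "sw ts ! 0 = ts ! i" if "length ts = r" for ts
    using that assms by (cases "i = 0") (auto simp: sw_def)
  show ?thesis
    by (rule sum.reindex_bij_witness[of _ sw sw])
       (use inv sw nth in \<open>auto simp: forests_with_def\<close>)
qed

text \<open>
  Exploring the tree along the path from the root to a vertex of height \<open>h\<close>: each ancestor with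
  \<open>k\<close> children is to be followed by one out of \<open>k\<close> exchangeable subtrees.
\<close>

lemma sum_level_size_forests_le:
  assumes "r > 0"
  shows "(\<Sum>ts\<in>forests_with r D. level_size h (ts ! 0)) \<le> (\<Sum>xs\<in>arrangements D. prod_list (take h xs))"
  using assms
proof (induction h arbitrary: r D)
  \<comment> \<open>Level 0 has one vertex and the empty product is 1, so this compares the number
    of forests with that of arrangements.\<close>
  case 0 then show ?case using card_forests_le by simp
next
  case (Suc h r D)
  show ?case
  proof (cases "D = {#}")
    case True
    have "forest_degs ts \<noteq> {#}" if "length ts = r" for ts
      using that Suc.prems forest_degs_Cons by (cases ts) (simp, metis add_mset_not_empty)
    then have "forests_with r D = {}" using True by (auto simp: forests_with_def)
    then show ?thesis by simp
  next
    case False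
    have "(\<Sum>ts\<in>forests_with r D. level_size (Suc h) (ts ! 0))
        = (\<Sum>k\<in>set_mset D. \<Sum>fs\<in>forests_with (r - 1 + k) (D - {#k#}). \<Sum>u\<leftarrow>take k fs. level_size h u)"
      by (subst sum_forests_first[OF Suc.prems]) simp
    also have "\<dots> \<le> (\<Sum>k\<in>set_mset D. k * (\<Sum>xs\<in>arrangements (D - {#k#}). prod_list (take h xs)))"
    proof (rule sum_mono)
      fix k assume "k \<in> set_mset D"
      let ?F = "forests_with (r - 1 + k) (D - {#k#})"
      have "(\<Sum>fs\<in>?F. \<Sum>u\<leftarrow>take k fs. level_size h u) = (\<Sum>fs\<in>?F. \<Sum>i<k. level_size h (fs ! i))"
        by (intro sum.cong refl) (auto simp: sum_list_conv_sum_lessThan forests_with_def)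
      also have "\<dots> = (\<Sum>i<k. \<Sum>fs\<in>?F. level_size h (fs ! i))" by (rule sum.swap)
      also have "\<dots> = (\<Sum>i<k. \<Sum>fs\<in>?F. level_size h (fs ! 0))"
        by (intro sum.cong refl sum_forests_swap) auto
      also have "\<dots> = k * (\<Sum>fs\<in>?F. level_size h (fs ! 0))" by simp
      \<comment> \<open>For \<open>k = 0\<close> both sides vanish; otherwise the new forest is
        nonempty, as the induction hypothesis requires.\<close>
      also have "\<dots> \<le> k * (\<Sum>xs\<in>arrangements (D - {#k#}). prod_list (take h xs))"
        by (cases "k = 0") (auto intro!: mult_left_mono Suc.IH)
      finally show "(\<Sum>fs\<in>?F. \<Sum>u\<leftarrow>take k fs. level_size h u)
          \<le> k * (\<Sum>xs\<in>arrangements (D - {#k#}). prod_list (take h xs))" .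
    qed
    also have "\<dots> = (\<Sum>xs\<in>arrangements D. prod_list (take (Suc h) xs))"
      by (simp add: sum_arrangements_first[OF False] sum_distrib_left)
    finally show ?thesis .
  qed
qed

lemma sum_level_size_trees_le:
  "(\<Sum>t\<in>trees_with D. level_size h t) \<le> (\<Sum>xs\<in>arrangements D. prod_list (take h xs))"
proof -
  have "(\<Sum>t\<in>trees_with D. level_size h t) = (\<Sum>ts\<in>(\<lambda>t. [t]) ` trees_with D. level_size h (ts ! 0))"
    by (subst sum.reindex) (auto simp: inj_on_def)
  also have "\<dots> \<le> (\<Sum>xs\<in>arrangements D. prod_list (take h xs))"
    unfolding forests_1[symmetric] by (rule sum_level_size_forests_le) simp
  finally show ?thesis .
qed

section \<open>Level sizes as lengths of the breadth-first queue\<close>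

lemma bfs_append: "bfs (ts @ us) = map (length \<circ> kids) ts @ bfs (us @ concat (map kids ts))"
  by (induction ts arbitrary: us) simp_all

text \<open>Once breadth-first search has processed all vertices before level \<open>h\<close>, the
  queue consists of precisely that level.\<close>

lemma queue_length_level:
  "\<exists>j\<le>length (bfs ts). length ts + sum_list (take j (bfs ts)) = j + (\<Sum>t\<leftarrow>ts. level_size h t)"
proof (induction h arbitrary: ts)
  case 0 then show ?case by (intro exI[of _ 0]) (simp add: sum_list_triv)
next
  case (Suc h ts)
  let ?us = "concat (map kids ts)"
  have bfs: "bfs ts = map (length \<circ> kids) ts @ bfs ?us" using bfs_append[of ts "[]"] by simp
  obtain j where j: "j \<le> length (bfs ?us)"
    "length ?us + sum_list (take j (bfs ?us)) = j + (\<Sum>t\<leftarrow>?us. level_size h t)"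
    using Suc by blast
  have "length ?us = sum_list (map (length \<circ> kids) ts)" by (simp add: length_concat comp_def)
  moreover have "(\<Sum>t\<leftarrow>?us. level_size h t) = (\<Sum>t\<leftarrow>ts. level_size (Suc h) t)"
    by (induction ts) simp_all
  ultimately show ?case using j unfolding bfs by (intro exI[of _ "length ts + j"]) simp
qed

section \<open>Width and height for given offspring numbers\<close>

lemma sum_mset_minus_1:
  assumes "sum_mset D + 1 = size D"
  shows "(\<Sum>x\<in>#D. real x - 1) = - 1"
proof -
  have "(\<Sum>x\<in>#D. real x - 1) = real (sum_mset D) - real (size D)" by (induction D) auto
  then show ?thesis using arg_cong[OF assms, of real] by simp
qed

lemma sum_list_minus_1: "(\<Sum>x\<leftarrow>xs. real x - 1) = real (sum_list xs) - real (length xs)"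
  by (induction xs) auto

text \<open>The maximal inequality controls suffix sums with at least about half of the entries
  left. A deviation at a late time is an early one for the reversed arrangement, which doubles the
  bound.\<close>

lemma card_arrangements_deviation_le:
  fixes u :: real
  assumes D: "sum_mset D + 1 = size D" and n: "size D \<ge> 6" and u: "u > 1"
  defines "q \<equiv> \<Sum>x\<in>#D. (real x - 1)\<^sup>2"
  assumes q: "q \<ge> 1"
  shows "(u - 1)\<^sup>2 * real (card {xs \<in> arrangements D.
            \<exists>j\<le>size D. u \<le> \<bar>real (sum_list (take j xs)) - real j\<bar>})
       \<le> 8 * q * real (card (arrangements D))"
proof -
  define n where "n = size D"
  \<comment> \<open>About half of \<open>n\<close>, rounded so that every \<open>j \<le> n\<close>
    has \<open>j \<le> n - m0\<close> or \<open>n - j \<le> n - m0\<close>.\<close>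
  define m0 where "m0 = (n + 1) div 2"
  \<comment> \<open>Passing from a prefix to the complementary suffix costs 1, as the total is -1;
    the suffix has at most \<open>n\<close> entries.\<close>
  define a where "a = (u - 1) / real n"
  define g where "g x = real x - 1" for x :: nat
  define A where "A = {xs \<in> arrangements D. \<exists>j\<le>n - m0.
      a \<le> \<bar>sum_list (map g (drop j xs))\<bar> / real (n - j)}"
  have n6: "n \<ge> 6" using n by (simp add: n_def)
  have m0: "2 \<le> m0" "m0 \<le> n" "m0 \<le> n - m0 + 1" "real m0 \<ge> real n / 2" using n6 by (auto simp: m0_def)
  have a: "a > 0" using u n6 by (simp add: a_def)
  have "a\<^sup>2 * real (card A) \<le> real (card (arrangements D)) *
      ((- 1 / real n)\<^sup>2 + (1 / (real m0 - 1) - 1 / (real n - 1)) * (q / real n))"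
    using maximal_inequality_arrangements[OF a m0(1) m0(2)[unfolded n_def], of g]
    unfolding A_def q_def n_def g_def sum_mset_minus_1[OF D] .
  also have "\<dots> \<le> real (card (arrangements D)) * (4 * q / (real n)\<^sup>2)"
  proof (rule mult_left_mono)
    \<comment> \<open>From \<open>m0 \<ge> n / 2\<close> and \<open>n \<ge> 6\<close>. The factor 4
      is 3 from here plus 1 from the squared mean.\<close>
    have "1 / (real m0 - 1) \<le> 1 / (real n / 3)"
      using m0 n6 by (intro divide_left_mono) (auto intro!: mult_pos_pos)
    also have "\<dots> = 3 / real n" by simp
    finally have "1 / (real m0 - 1) - 1 / (real n - 1) \<le> 3 / real n - 0"
      using n6 by (intro diff_mono) auto
    then have "1 / (real m0 - 1) - 1 / (real n - 1) \<le> 3 / real n" by (simp only: diff_zero)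
    then have "(1 / (real m0 - 1) - 1 / (real n - 1)) * (q / real n) \<le> 3 / real n * (q / real n)"
      using q by (intro mult_right_mono) auto
    moreover have "(- 1 / real n)\<^sup>2 \<le> q / (real n)\<^sup>2" using q by (simp add: power_divide divide_right_mono)
    ultimately show "(- 1 / real n)\<^sup>2 + (1 / (real m0 - 1) - 1 / (real n - 1)) * (q / real n)
        \<le> 4 * q / (real n)\<^sup>2" by (simp add: power2_eq_square)
  qed simp
  finally have "(real n)\<^sup>2 * (a\<^sup>2 * real (card A))
      \<le> (real n)\<^sup>2 * (real (card (arrangements D)) * (4 * q / (real n)\<^sup>2))"
    by (intro mult_left_mono) auto
  then have cardA: "(u - 1)\<^sup>2 * real (card A) \<le> 4 * q * real (card (arrangements D))"
    using n6 by (simp add: a_def power_divide mult_ac)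
  have "{xs \<in> arrangements D. \<exists>j\<le>n. u \<le> \<bar>real (sum_list (take j xs)) - real j\<bar>} \<subseteq> A \<union> rev ` A"
  proof
    fix xs assume xs: "xs \<in> {xs \<in> arrangements D. \<exists>j\<le>n. u \<le> \<bar>real (sum_list (take j xs)) - real j\<bar>}"
    then obtain j where j: "j \<le> n" "u \<le> \<bar>real (sum_list (take j xs)) - real j\<bar>" by blast
    have len: "length xs = n" using xs by (auto simp: n_def dest: length_finite_permutations_of_multiset)
    have "sum_list xs = sum_mset D"
      using xs by (metis (no_types, lifting) mem_Collect_eq permutations_of_multisetD sum_mset_sum_list)
    then have "sum_list xs + 1 = n" using D by (simp add: n_def)
    then have sum: "real (sum_list xs) = real n - 1" by (metis add_diff_cancel_right' of_nat_1 of_nat_add)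
    have take: "sum_list (map g (take j xs)) = real (sum_list (take j xs)) - real j"
      unfolding g_def sum_list_minus_1 using len j by simp
    have "sum_list (map g (take j xs)) + sum_list (map g (drop j xs)) = sum_list (map g xs)"
      by (metis append_take_drop_id map_append sum_list_append)
    also have "\<dots> = - 1" unfolding g_def sum_list_minus_1 using sum len by simp
    finally have drop: "\<bar>sum_list (map g (drop j xs))\<bar> \<ge> u - 1" using take j(2) by linarith
    have rev_A: "xs \<in> A \<union> rev ` A" if "xs \<in> A \<or> rev xs \<in> A"
      using that by (metis UnI1 UnI2 imageI rev_rev_ident)
    show "xs \<in> A \<union> rev ` A"
    proof (rule rev_A, cases "j \<le> n - m0")
      case True
      have "a \<le> \<bar>sum_list (map g (drop j xs))\<bar> / real (n - j)"
        unfolding a_def using drop u True m0 by (intro frac_le) auto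
      then show "xs \<in> A \<or> rev xs \<in> A" using xs True by (auto simp: A_def)
    next
      case False
      then have jm: "j \<ge> m0" "n - j \<le> n - m0" "n - (n - j) = j" "j > 0" using m0 j by auto
      have "drop (n - j) (rev xs) = rev (take j xs)" using len j by (simp add: drop_rev)
      then have "\<bar>sum_list (map g (drop (n - j) (rev xs)))\<bar> \<ge> u - 1"
        using take j(2) by (simp add: sum_list_rev rev_map[symmetric])
      then have "a \<le> \<bar>sum_list (map g (drop (n - j) (rev xs)))\<bar> / real (n - (n - j))"
        unfolding a_def jm(3) using u jm j by (intro frac_le) auto
      moreover have "rev xs \<in> arrangements D" using xs by (simp add: permutations_of_multiset_def)
      ultimately show "xs \<in> A \<or> rev xs \<in> A" using jm(2) unfolding A_def by blast
    qed
  qed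
  then have "card {xs \<in> arrangements D. \<exists>j\<le>n. u \<le> \<bar>real (sum_list (take j xs)) - real j\<bar>}
      \<le> card (A \<union> rev ` A)"
    by (intro card_mono) (auto simp: A_def)
  also have "\<dots> \<le> card A + card (rev ` A)" by (rule card_Un_le)
  also have "card (rev ` A) = card A" by (rule card_image) simp
  finally have "real (card {xs \<in> arrangements D. \<exists>j\<le>n. u \<le> \<bar>real (sum_list (take j xs)) - real j\<bar>})
      \<le> 2 * real (card A)" by simp
  then have "(u - 1)\<^sup>2 * real (card {xs \<in> arrangements D. \<exists>j\<le>n. u \<le> \<bar>real (sum_list (take j xs)) - real j\<bar>})
      \<le> (u - 1)\<^sup>2 * (2 * real (card A))"
    by (rule mult_left_mono) simp
  then show ?thesis using cardA by (simp add: n_def)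
qed

text \<open>Up to a correction of 0 or -1, each value of the path of \<open>xs\<close> is a
  difference of two values of the rotated path, so one of these is at least about half as large in
  absolute value.\<close>

lemma rotate_deviation:
  fixes w :: real
  assumes "sum_list xs + 1 = length xs" "i < length xs" "j \<le> length xs"
    and w: "w < 1 + (real (sum_list (take j xs)) - real j)"
  shows "\<exists>k\<le>length xs. (w - 1) / 2 \<le> \<bar>real (sum_list (take k (rotate i xs))) - real k\<bar>"
proof (rule ccontr)
  define n where "n = length xs"
  define P where "P zs k = real (sum_list (take k zs)) - real k" for zs :: "nat list" and k
  assume neg: "\<not> ?thesis"
 have small: "\<bar>P (rotate i xs) k\<bar> < (w - 1) / 2" if "k \<le> n" for k
    using neg that unfolding P_def n_def by (meson not_le)
  have tot: "real (sum_list xs) = real n - 1" using assms(1) by (simp add: n_def)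
  have rot: "P (rotate i xs) k + P xs i = (if i + k \<le> n then P xs (i + k) else P xs (i + k - n) - 1)"
    if "k \<le> n" for k
    using arg_cong[OF sum_list_take_rotate[of i xs k], of real] that assms(2) tot
    by (auto simp: P_def n_def of_nat_diff)
  \<comment> \<open>At time \<open>n - i\<close> the rotated path has reached the end of
    \<open>xs\<close> and continues from its beginning.\<close>
  have end_: "P (rotate i xs) (n - i) + P xs i = - 1"
    using rot[of "n - i"] assms(2) tot by (simp add: P_def n_def)
  have "\<exists>k\<le>n. P xs j = P (rotate i xs) k - P (rotate i xs) (n - i) - (if i \<le> j then 1 else 0)"
  proof (cases "i \<le> j")
    case True
    then have "P (rotate i xs) (j - i) + P xs i = P xs j" "j - i \<le> n"
      using rot[of "j - i"] assms(3) by (simp_all add: n_def)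
    then have "P xs j = P (rotate i xs) (j - i) - P (rotate i xs) (n - i) - 1" "j - i \<le> n"
      using end_ by linarith+
    then show ?thesis using True by auto
  next
    case False
    show ?thesis
    proof (cases "j = 0")
      case True
      then show ?thesis using False assms by (intro exI[of _ "n - i"]) (auto simp: P_def n_def)
    next
      case j0: False
      have k: "j + n - i \<le> n" "i + (j + n - i) - n = j" "\<not> i + (j + n - i) \<le> n"
        using False j0 assms(2) by (auto simp: n_def)
      have "P (rotate i xs) (j + n - i) + P xs i = P xs j - 1"
        using rot[OF k(1)] k(2,3) by simp
      then have "P xs j = P (rotate i xs) (j + n - i) - P (rotate i xs) (n - i)"
        using end_ by linarith
      then show ?thesis using False k(1) by auto
    qed
  qed
  then obtain k where k: "k \<le> n" "P xs j \<le> P (rotate i xs) k - P (rotate i xs) (n - i)" by auto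
  then have "\<bar>P (rotate i xs) k\<bar> * 2 < w - 1" "\<bar>P (rotate i xs) (n - i)\<bar> * 2 < w - 1"
    using small[of k] small[of "n - i"] by (simp_all add: field_simps)
  then have "P xs j < w - 1" using k(2) by linarith
  then show False using w by (simp add: P_def)
qed

text \<open>A wide tree has a breadth-first excursion with a large value, and its \<open>n\<close>
  rotations, all distinct, deviate about half as much. There are \<open>n\<close> times as many
  arrangements as trees, so the factor \<open>n\<close> cancels.\<close>

lemma card_wide_trees_le:
  fixes w :: real
  assumes D: "sum_mset D + 1 = size D" and n: "size D \<ge> 6" and w: "w \<ge> 6"
  defines "q \<equiv> \<Sum>x\<in>#D. (real x - 1)\<^sup>2"
  assumes q: "q \<ge> 1"
  shows "real (card {t \<in> trees_with D. w < real (Wd (verts t))}) \<le> 128 * q / w\<^sup>2 * real (card (trees_with D))"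
proof -
  define n where "n = size D"
  define W where "W = {t \<in> trees_with D. w < real (Wd (verts t))}"
  define B where "B = {xs \<in> arrangements D. excursion xs \<and>
      (\<exists>j\<le>n. w < 1 + (real (sum_list (take j xs)) - real j))}"
  define V where "V = {xs \<in> arrangements D. \<exists>j\<le>n. (w - 1) / 2 \<le> \<bar>real (sum_list (take j xs)) - real j\<bar>}"
  have "card W \<le> card B"
  proof (rule card_inj_on_le[of "\<lambda>t. bfs [t]"])
    show "inj_on (\<lambda>t. bfs [t]) W"
      by (rule inj_on_subset[OF bij_betw_imp_inj_on[OF bij_betw_bfs_trees]]) (auto simp: W_def)
    show "(\<lambda>t. bfs [t]) ` W \<subseteq> B"
    proof (rule image_subsetI)
      fix t assume t: "t \<in> W"
      then have "bfs [t] \<in> {xs \<in> arrangements D. excursion xs}"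
        by (intro bij_betw_apply[OF bij_betw_bfs_trees]) (simp add: W_def)
      then have b: "bfs [t] \<in> arrangements D" "excursion (bfs [t])" by auto
      obtain h where "Wd (verts t) = level_size h t" using Wd_verts by blast
      moreover obtain j where j: "j \<le> length (bfs [t])"
        "length [t] + sum_list (take j (bfs [t])) = j + (\<Sum>t\<leftarrow>[t]. level_size h t)"
        using queue_length_level[of "[t]" h] by blast
      ultimately have "real (Wd (verts t)) = 1 + (real (sum_list (take j (bfs [t]))) - real j)"
        using arg_cong[OF j(2), of real] by (simp del: bfs.simps)
      moreover have "j \<le> n"
        using j(1) length_finite_permutations_of_multiset[OF b(1)] by (simp add: n_def)
      ultimately show "bfs [t] \<in> B" using b t by (auto simp: B_def W_def simp del: bfs.simps)
    qed
    show "finite B" by (simp add: B_def)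
  qed
  moreover have "card (B \<times> {..<n}) \<le> card V"
  proof (rule card_inj_on_le)
    show "inj_on (\<lambda>(xs, i). rotate i xs) (B \<times> {..<n})"
      by (rule inj_on_subset[OF inj_on_rotate_excursion_arrangements[of D]]) (auto simp: B_def n_def)
    show "(\<lambda>(xs, i). rotate i xs) ` (B \<times> {..<n}) \<subseteq> V"
    proof (rule image_subsetI)
      fix p assume "p \<in> B \<times> {..<n}"
      then obtain xs i where p: "p = (xs, i)" and xs: "xs \<in> B" and i: "i < n" by auto
      then obtain j where j: "j \<le> n" "w < 1 + (real (sum_list (take j xs)) - real j)"
        by (auto simp: B_def)
      have len: "length xs = n"
        using xs by (auto simp: B_def n_def dest: length_finite_permutations_of_multiset)
      have "sum_list xs + 1 = length xs" using xs by (simp add: B_def excursion_def)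
      from rotate_deviation[OF this _ _ j(2), of i] xs i j len
      show "(\<lambda>(xs, i). rotate i xs) p \<in> V" by (auto simp: p V_def B_def intro: arrangements_rotate)
    qed
    show "finite V" by (simp add: V_def)
  qed
  then have "n * card B \<le> card V" by (simp add: card_cartesian_product mult.commute)
  ultimately have "n * card W \<le> card V" by (meson le_trans mult_le_mono2)
  then have nW: "real n * real (card W) \<le> real (card V)" by (metis of_nat_le_iff of_nat_mult)
  \<comment> \<open>Here \<open>w \<ge> 6\<close> gives \<open>w / 4 \<le> (w - 1) / 2 - 1\<close>;
    squaring the quarter turns 8 into 128.\<close>
  have "(w / 4)\<^sup>2 * (real n * real (card W)) \<le> ((w - 1) / 2 - 1)\<^sup>2 * real (card V)"
  proof (intro mult_mono power_mono nW)
    show "w / 4 \<le> (w - 1) / 2 - 1" using w by (simp add: field_simps)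
  qed (use w in auto)
  also have "\<dots> \<le> 8 * q * real (card (arrangements D))"
    unfolding V_def n_def q_def
    by (rule card_arrangements_deviation_le[OF D n]) (use w q in \<open>auto simp: q_def\<close>)
  also have "\<dots> = 8 * q * (real n * real (card (trees_with D)))"
    using card_trees[OF D] by (metis n_def of_nat_mult)
  finally have "real n * ((w / 4)\<^sup>2 * real (card W)) \<le> real n * (8 * q * real (card (trees_with D)))"
    by (simp add: mult_ac)
  then have "(w / 4)\<^sup>2 * real (card W) \<le> 8 * q * real (card (trees_with D))"
    using n by (simp add: n_def)
  then show ?thesis using w by (simp add: W_def[symmetric] field_simps power2_eq_square)
qed

section \<open>Height of a uniform tree with given offspring numbers\<close>

lemma card_high_trees_le:
  fixes \<theta> :: real
  assumes D: "sum_mset D + 1 = size D" and big: "\<exists>x\<in>#D. x \<ge> 2"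
    and \<theta>: "0 \<le> \<theta>" "\<theta> \<le> 1" and h: "2 * real (size D) * \<theta> \<le> real h"
  shows "real (card {t \<in> trees_with D. h \<le> Ht (verts t)})
     \<le> 2 * real (size D) * exp (- ((\<theta> * sqrt (\<Sum>x\<in>#D. (real x - 1)\<^sup>2) - 1) / 8)) * real (card (trees_with D))"
proof -
  define n where "n = size D"
  define N where "N = real (card {t \<in> trees_with D. h \<le> Ht (verts t)})"
  define X where "X = exp (- ((\<theta> * sqrt (\<Sum>x\<in>#D. (real x - 1)\<^sup>2) - 1) / 8))"
  define a where "a = real (card (arrangements D))"
  have level: "N * real (n choose g) \<le> a * esym D g" if "g \<le> h" for g
  proof -
    have "card {t \<in> trees_with D. h \<le> Ht (verts t)} = (\<Sum>t\<in>{t \<in> trees_with D. h \<le> Ht (verts t)}. 1)" by simp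
    also have "\<dots> \<le> (\<Sum>t\<in>{t \<in> trees_with D. h \<le> Ht (verts t)}. level_size g t)"
      using that by (intro sum_mono level_size_pos) auto
    also have "\<dots> \<le> (\<Sum>t\<in>trees_with D. level_size g t)" by (intro sum_mono2) (auto simp: finite_trees)
    also have "\<dots> \<le> (\<Sum>xs\<in>arrangements D. prod_list (take g xs))" by (rule sum_level_size_trees_le)
    finally have "N \<le> (\<Sum>xs\<in>arrangements D. real (prod_list (take g xs)))"
      unfolding N_def by (metis of_nat_le_iff of_nat_sum)
    then show ?thesis
      using sum_prod_take_arrangements[of g D] by (simp add: n_def a_def mult_right_mono flip: sum_prod_take_arrangements)
  qed
  \<comment> \<open>Since \<open>h\<close> is at least twice \<open>n * \<theta>\<close>, the
    indices up to \<open>h\<close> carry at least half of the binomial weights.\<close>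
  have "N * (1 + \<theta>) ^ n \<le> N * (2 * (\<Sum>g\<le>h. real (n choose g) * \<theta> ^ g))"
    using binomial_sum_atMost_ge[OF \<theta>(1) h] by (intro mult_left_mono) (auto simp: N_def n_def)
  also have "\<dots> = 2 * (\<Sum>g\<le>h. (N * real (n choose g)) * \<theta> ^ g)"
    by (simp add: sum_distrib_left mult_ac)
  also have "\<dots> \<le> 2 * (\<Sum>g\<le>h. (a * esym D g) * \<theta> ^ g)"
    using level \<theta> by (intro mult_left_mono sum_mono mult_right_mono) auto
  also have "\<dots> = 2 * a * (\<Sum>g\<le>h. esym D g * \<theta> ^ g)"
    by (simp add: sum_distrib_left mult_ac)
  also have "\<dots> \<le> 2 * a * ((1 + \<theta>) ^ n * X)"
    using order.trans[OF sum_esym_le[OF \<theta>(1)] prod_one_plus_le[OF \<theta> D big]]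
    by (intro mult_left_mono) (auto simp: n_def X_def a_def)
  finally have "N * (1 + \<theta>) ^ n \<le> (2 * a * X) * (1 + \<theta>) ^ n" by (simp add: mult_ac)
  then have "N \<le> 2 * a * X" using \<theta> by simp
  also have "a = real n * real (card (trees_with D))"
    unfolding a_def n_def using card_trees[OF D] by (metis of_nat_mult)
  finally show ?thesis by (simp add: N_def X_def n_def mult_ac)
qed

section \<open>Trees of a given size, and the product of width and height\<close>

lemma degs_sum_size: "sum_mset (degs t) + 1 = size (degs t)"
proof -
  have "mset (bfs [t]) = degs t" using mset_bfs[of "[t]"] by (simp del: bfs.simps)
  moreover have "sum_list (bfs [t]) + 1 = length (bfs [t])"
    using queue_path_bfs[of "[t]"] unfolding queue_path_def by (simp del: bfs.simps)
  ultimately show ?thesis by (metis size_mset sum_mset_sum_list)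
qed

lemma finite_trees_of_size: "finite {t. size (degs t) = n}"
proof (rule finite_imageD)
  show "inj_on (\<lambda>t. bfs [t]) {t. size (degs t) = n}"
  proof (rule inj_onI)
    fix t u assume "bfs [t] = bfs [u]"
    then show "t = u" using bfs_inj[of "[t]" "[u]"] by (simp del: bfs.simps)
  qed
  have "(\<lambda>t. bfs [t]) ` {t. size (degs t) = n} \<subseteq> {xs. set xs \<subseteq> {..n} \<and> length xs = n}"
  proof (rule image_subsetI)
    fix t assume t: "t \<in> {t. size (degs t) = n}"
    have m: "mset (bfs [t]) = degs t" using mset_bfs[of "[t]"] by (simp del: bfs.simps)
    then have len: "length (bfs [t]) = n" using t by (metis mem_Collect_eq size_mset)
    moreover have "sum_list (bfs [t]) + length [t] = length (bfs [t])"
      using queue_path_bfs[of "[t]"] unfolding queue_path_def by blast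
    then have sum: "sum_list (bfs [t]) \<le> n" using len by linarith
    have "x \<le> n" if "x \<in> set (bfs [t])" for x
      using member_le_sum_list[OF that] sum by linarith
    then have "set (bfs [t]) \<subseteq> {..n}" by blast
    ultimately show "bfs [t] \<in> {xs. set xs \<subseteq> {..n} \<and> length xs = n}" by blast
  qed
  then show "finite ((\<lambda>t. bfs [t]) ` {t. size (degs t) = n})"
    by (rule finite_subset) (rule finite_lists_length_eq, simp)
qed

lemma Wd_verts_le: "Wd (verts t) \<le> size (degs t)"
  using Wd_verts[of t] level_size_le by metis

text \<open>On naturals \<open>1 - x \<le> (x - 1)\<^sup>2\<close>, with equality at 0 and 1, and
  the left-hand sides sum to 1.\<close>

lemma sum_square_offspring:
  assumes "sum_mset D + 1 = size D"
  shows "(\<Sum>x\<in>#D. (real x - 1)\<^sup>2) \<ge> 1"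
    and "\<not> (\<exists>x\<in>#D. x \<ge> 2) \<Longrightarrow> (\<Sum>x\<in>#D. (real x - 1)\<^sup>2) = 1"
proof -
  have one: "(\<Sum>x\<in>#D. 1 - real x) = 1"
  proof -
    have "(\<Sum>x\<in>#D. 1 - real x) = - (\<Sum>x\<in>#D. real x - 1)" by (induction D) auto
    then show ?thesis using sum_mset_minus_1[OF assms] by simp
  qed
  have "1 - real x \<le> (real x - 1)\<^sup>2" for x
  proof (cases x)
    case (Suc k)
    then show ?thesis by (simp add: order.trans[OF _ zero_le_power2])
  qed simp
  then have "(\<Sum>x\<in>#D. 1 - real x) \<le> (\<Sum>x\<in>#D. (real x - 1)\<^sup>2)" by (intro sum_mset_mono)
  then show "(\<Sum>x\<in>#D. (real x - 1)\<^sup>2) \<ge> 1" using one by simp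
  assume small: "\<not> (\<exists>x\<in>#D. x \<ge> 2)"
  have "(real x - 1)\<^sup>2 = 1 - real x" if "x \<in># D" for x
  proof -
    have "x = 0 \<or> x = 1" using small that by force
    then show ?thesis by auto
  qed
  then have "(\<Sum>x\<in>#D. (real x - 1)\<^sup>2) = (\<Sum>x\<in>#D. 1 - real x)"
    by (intro arg_cong[where f = sum_mset] image_mset_cong)
  then show "(\<Sum>x\<in>#D. (real x - 1)\<^sup>2) = 1" using one by simp
qed

text \<open>The thresholds \<open>w\<close> for the width and \<open>2 * n * \<theta>\<close> for
  the height multiply to the threshold for the product, so one of them is exceeded.\<close>

lemma card_wide_high_trees_le:
  fixes s :: real
  assumes D: "sum_mset D + 1 = size D" and n: "size D \<ge> 3" and s: "s \<ge> 10 ^ 6"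
  shows "real (card {t \<in> trees_with D. s * (real (size D) * ln (real (size D)))
             < real (Wd (verts t)) * real (Ht (verts t))}) \<le> 4 / s * real (card (trees_with D))"
    (is "real (card ?B) \<le> _")
proof (cases "?B = {}")
  case True
  then show ?thesis using s by (simp only: card.empty) simp
next
  case False
  define n where "n = size D"
  define q where "q = (\<Sum>x\<in>#D. (real x - 1)\<^sup>2)"
  define \<sigma> where "\<sigma> = sqrt q"
  define w where "w = s / 32 * \<sigma>"
  \<comment> \<open>With the constant 16, \<open>\<theta> * \<sigma> / 8\<close> is
    \<open>2 * ln n\<close>, so the exponential is of order \<open>1 / n\<^sup>2\<close> and
    outweighs the factor \<open>2 * n\<close>. The 32 in \<open>w\<close> is twice 16.\<close>
  define \<theta> where "\<theta> = 16 * ln (real n) / \<sigma>"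
  define h where "h = nat \<lceil>2 * real n * \<theta>\<rceil>"
  define N where "N = real (card (trees_with D))"
  have Ht_n: "Ht (verts t) < n" if "t \<in> trees_with D" for t
    using Ht_verts_less[of t] that by (simp add: trees_with_def n_def)
  have "exp 1 \<le> real n" using exp_le n by (simp add: n_def)
  then have ln_n: "ln (real n) \<ge> 1" using n by (subst ln_ge_iff) (auto simp: n_def)
  \<comment> \<open>Width and height are at most \<open>n\<close> and \<open>ln n \<ge> 1\<close>,
    so a tree in \<open>?B\<close> limits \<open>s\<close>; this lets \<open>3 / n\<close> be
    replaced by \<open>3 / s\<close> later.\<close>
  have s_n: "s < real n"
  proof -
    obtain t where t: "t \<in> ?B" using False by blast
    have "s * real n * 1 \<le> s * real n * ln (real n)"
      using ln_n s by (intro mult_left_mono) auto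
    also have "\<dots> < real (Wd (verts t)) * real (Ht (verts t))" using t by (simp add: n_def mult_ac)
    also have "\<dots> \<le> real n * real n"
      using t Wd_verts_le[of t] Ht_n[of t] by (intro mult_mono) (auto simp: trees_with_def n_def)
    finally have "s * real n < real n * real n" by simp
    then show ?thesis by (rule mult_right_less_imp_less) simp
  qed
  have n6: "n \<ge> 6" using s_n s by simp
  have q: "q \<ge> 1" using sum_square_offspring(1)[OF D] by (simp add: q_def)
  then have \<sigma>: "\<sigma> \<ge> 1" "\<sigma>\<^sup>2 = q" by (auto simp: \<sigma>_def)
  have w: "w \<ge> 6" using mult_mono[of 6 "s / 32" 1 \<sigma>] s \<sigma> by (simp add: w_def)
  have \<theta>0: "\<theta> \<ge> 0" using ln_n \<sigma> by (simp add: \<theta>_def)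
  have "?B \<subseteq> {t \<in> trees_with D. w < real (Wd (verts t))} \<union> {t \<in> trees_with D. 2 * real n * \<theta> < real (Ht (verts t))}"
  proof
    fix t assume t: "t \<in> ?B"
    have "2 * real n * \<theta> < real (Ht (verts t))" if "\<not> w < real (Wd (verts t))"
    proof -
      have "w * (2 * real n * \<theta>) = s * (real n * ln (real n))"
        using \<sigma> by (simp add: w_def \<theta>_def)
      also have "\<dots> < real (Wd (verts t)) * real (Ht (verts t))" using t by (simp add: n_def)
      also have "\<dots> \<le> w * real (Ht (verts t))" using that by (intro mult_right_mono) auto
      finally show ?thesis using w by simp
    qed
    then show "t \<in> {t \<in> trees_with D. w < real (Wd (verts t))} \<union> {t \<in> trees_with D. 2 * real n * \<theta> < real (Ht (verts t))}"
      using t by blast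
  qed
  then have "card ?B \<le> card ({t \<in> trees_with D. w < real (Wd (verts t))} \<union> {t \<in> trees_with D. 2 * real n * \<theta> < real (Ht (verts t))})"
    by (intro card_mono) (auto simp: finite_trees)
  also have "\<dots> \<le> card {t \<in> trees_with D. w < real (Wd (verts t))}
      + card {t \<in> trees_with D. 2 * real n * \<theta> < real (Ht (verts t))}"
    by (rule card_Un_le)
  finally have "real (card ?B) \<le> real (card {t \<in> trees_with D. w < real (Wd (verts t))})
      + real (card {t \<in> trees_with D. 2 * real n * \<theta> < real (Ht (verts t))})"
    by linarith
  also have "\<dots> \<le> 1 / s * N + 3 / s * N"
  proof (rule add_mono)
    have "real (card {t \<in> trees_with D. w < real (Wd (verts t))}) \<le> 128 * q / w\<^sup>2 * N"
      unfolding q_def N_def by (rule card_wide_trees_le[OF D]) (use n6 w q in \<open>auto simp: n_def q_def\<close>)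
    also have "\<dots> \<le> 1 / s * N"
    proof (rule mult_right_mono)
      \<comment> \<open>The constant is \<open>128 * 32\<^sup>2\<close>, which is below
        \<open>s\<close>.\<close>
      have "128 * q / w\<^sup>2 = 131072 / (s * s)"
        unfolding \<sigma>(2)[symmetric] using \<sigma>(1) s by (simp add: w_def power2_eq_square field_simps)
      also have "\<dots> \<le> s / (s * s)" using s by (intro divide_right_mono) auto
      finally show "128 * q / w\<^sup>2 \<le> 1 / s" using s by simp
    qed (simp add: N_def)
    finally show "real (card {t \<in> trees_with D. w < real (Wd (verts t))}) \<le> 1 / s * N" .
    show "real (card {t \<in> trees_with D. 2 * real n * \<theta> < real (Ht (verts t))}) \<le> 3 / s * N"
    proof (cases "\<theta> \<le> 1")
      case False
      have "\<not> 2 * real n * \<theta> < real (Ht (verts t))" if "t \<in> trees_with D" for t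
      proof -
        have "real n * 1 \<le> 2 * real n * \<theta>" using False n6 by (intro mult_mono) auto
        then show ?thesis using Ht_n[OF that] by linarith
      qed
      then have none: "{t \<in> trees_with D. 2 * real n * \<theta> < real (Ht (verts t))} = {}" by blast
      show ?thesis unfolding none using s by (simp add: N_def)
    next
      case True
      \<comment> \<open>With all offspring numbers at most 1, \<open>\<sigma>\<close> would be 1 and
        \<open>\<theta>\<close> at least 16.\<close>
      have big: "\<exists>x\<in>#D. x \<ge> 2"
      proof (rule ccontr)
        assume "\<not> (\<exists>x\<in>#D. x \<ge> 2)"
        then have "\<sigma> = 1" using sum_square_offspring(2)[OF D] by (simp add: \<sigma>_def q_def)
        then show False using True ln_n by (simp add: \<theta>_def)
      qed
      have "card {t \<in> trees_with D. 2 * real n * \<theta> < real (Ht (verts t))} \<le> card {t \<in> trees_with D. h \<le> Ht (verts t)}"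
        by (intro card_mono) (auto simp: finite_trees h_def nat_le_iff ceiling_le_iff)
      then have "real (card {t \<in> trees_with D. 2 * real n * \<theta> < real (Ht (verts t))})
          \<le> real (card {t \<in> trees_with D. h \<le> Ht (verts t)})" by simp
      also have "\<dots> \<le> 2 * real n * exp (- ((\<theta> * \<sigma> - 1) / 8)) * N"
        unfolding n_def \<sigma>_def q_def N_def
        by (rule card_high_trees_le[OF D big \<theta>0 True]) (auto simp: h_def n_def intro: real_nat_ceiling_ge)
      also have "\<dots> \<le> 3 / s * N"
      proof (rule mult_right_mono)
        have "exp (- ((\<theta> * \<sigma> - 1) / 8)) = exp (1 / 8 - 2 * ln (real n))"
          using \<sigma> by (simp add: \<theta>_def field_simps)
        also have "\<dots> = exp (1 / 8) / (real n)\<^sup>2"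
          using n6 by (simp add: exp_diff exp_of_nat_mult[of 2 "ln (real n)", simplified])
        also have "\<dots> \<le> (3 / 2) / (real n)\<^sup>2"
          using exp_bound[of "1 / 8"] by (intro divide_right_mono) (auto simp: power2_eq_square)
        finally have "2 * real n * exp (- ((\<theta> * \<sigma> - 1) / 8)) \<le> 2 * real n * ((3 / 2) / (real n)\<^sup>2)"
          by (intro mult_left_mono) auto
        also have "\<dots> = 3 / real n" using n6 by (simp add: power2_eq_square)
        also have "\<dots> \<le> 3 / s" using s_n s by (intro divide_left_mono) auto
        finally show "2 * real n * exp (- ((\<theta> * \<sigma> - 1) / 8)) \<le> 3 / s" .
      qed (simp add: N_def)
      finally show ?thesis .
    qed
  qed
  also have "\<dots> = 4 / s * N" by (simp add: field_simps)
  finally show ?thesis by (simp add: N_def)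
qed

section \<open>Random trees\<close>

text \<open>Only finitely many plane trees have size \<open>n\<close>, so the event is a finite
  disjoint union of events \<open>T w = verts t\<close>.\<close>

lemma prob_bienayme_tree_size:
  assumes T: "bienayme_tree M \<mu> T" and n: "n > 0"
  shows "\<P>(w in M. R (T w) \<and> card (T w) = n)
       = (\<Sum>t | size (degs t) = n \<and> R (verts t). \<Prod>k\<in>#degs t. pmf \<mu> k)"
proof -
  interpret prob_space M using T by (simp add: bienayme_tree_def)
  have meas: "T \<in> M \<rightarrow>\<^sub>M plane_tree_space" using T by (simp add: bienayme_tree_def)
  let ?S = "{t. size (degs t) = n \<and> R (verts t)}"
  let ?E = "\<lambda>t. {w \<in> space M. T w = verts t}"
  have fin: "finite ?S" by (rule finite_subset[OF _ finite_trees_of_size[of n]]) auto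
  have "{w \<in> space M. R (T w) \<and> card (T w) = n} = (\<Union>t\<in>?S. ?E t)"
  proof (intro equalityI subsetI)
    fix w assume w: "w \<in> {w \<in> space M. R (T w) \<and> card (T w) = n}"
    then have "plane_tree (T w)" using measurable_space[OF meas, of w] by simp
    \<comment> \<open>An infinite set has \<open>card\<close> 0, so \<open>n > 0\<close> forces
      finiteness.\<close>
    moreover have "finite (T w)" using w n by (intro card_ge_0_finite) simp
    ultimately obtain t where t: "verts t = T w" using verts_surj by blast
    then have "t \<in> ?S" using w card_verts[of t] by simp
    then show "w \<in> (\<Union>t\<in>?S. ?E t)" using t w by auto
  qed (auto simp: card_verts)
  then have "\<P>(w in M. R (T w) \<and> card (T w) = n) = prob (\<Union>t\<in>?S. ?E t)" by simp
  also have "\<dots> = (\<Sum>t\<in>?S. prob (?E t))"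
  proof (rule finite_measure_finite_Union[OF fin])
    show "?E ` ?S \<subseteq> events"
    proof (rule image_subsetI)
      fix t
      have "T -` {verts t} \<inter> space M \<in> events"
        by (rule measurable_sets[OF meas sets_plane_tree_space_singleton[OF plane_tree_verts]])
      also have "T -` {verts t} \<inter> space M = ?E t" by auto
      finally show "?E t \<in> events" .
    qed
    show "disjoint_family_on ?E ?S"
      using inj_verts by (auto simp: disjoint_family_on_def inj_def)
  qed
  also have "\<dots> = (\<Sum>t\<in>?S. \<Prod>k\<in>#degs t. pmf \<mu> k)"
    by (intro sum.cong refl)
       (simp add: prob_bienayme_tree_eq[OF T plane_tree_verts finite_verts] prod_num_children_verts)
  finally show ?thesis .
qed

text \<open>The weight depends only on the offspring multiset: given \<open>D\<close>, all trees in
  \<open>trees_with D\<close> weigh the same, and counting them suffices.\<close>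

lemma sum_trees_group:
  "(\<Sum>t | size (degs t) = n \<and> R t. f (degs t))
     = (\<Sum>D\<in>degs ` {t. size (degs t) = n}. f D * real (card {t \<in> trees_with D. R t}))"
proof -
  let ?S = "{t. size (degs t) = n \<and> R t}" and ?\<D> = "degs ` {t. size (degs t) = n}"
  have fin: "finite ?S" by (rule finite_subset[OF _ finite_trees_of_size[of n]]) auto
  have "(\<Sum>t\<in>?S. f (degs t)) = (\<Sum>D\<in>?\<D>. \<Sum>t\<in>{t \<in> ?S. degs t = D}. f (degs t))"
    by (rule sum.group[symmetric]) (auto simp: fin finite_trees_of_size)
  also have "\<dots> = (\<Sum>D\<in>?\<D>. f D * real (card {t \<in> trees_with D. R t}))"
  proof (rule sum.cong[OF refl])
    fix D assume "D \<in> ?\<D>"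
    then have "{t \<in> ?S. degs t = D} = {t \<in> trees_with D. R t}" by (auto simp: trees_with_def)
    moreover have "(\<Sum>t\<in>{t \<in> trees_with D. R t}. f (degs t)) = (\<Sum>t\<in>{t \<in> trees_with D. R t}. f D)"
      by (rule sum.cong) (auto simp: trees_with_def)
    ultimately show "(\<Sum>t\<in>{t \<in> ?S. degs t = D}. f (degs t)) = f D * real (card {t \<in> trees_with D. R t})"
      by simp
  qed
  finally show ?thesis .
qed

theorem theorem1p1:
  fixes \<mu> :: "nat pmf" and n :: nat and M :: "'w measure" and T :: "'w \<Rightarrow> nat list set" and s :: real
  assumes "bienayme_tree M \<mu> T"
    and "n \<ge> 3"
    and "\<P>(w in M. card (T w) = n) > 0"
    and "s > 0"
  shows "\<P>(w in M. real (Wd (T w)) * real (Ht (T w)) > s * (real n * ln (real n)) \<bar> card (T w) = n)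
           \<le> 230 * s powr (- 2 / 13)"
proof -
  define R where "R A \<longleftrightarrow> real (Wd A) * real (Ht A) > s * (real n * ln (real n))" for A
  define f where "f D = (\<Prod>k\<in>#D. pmf \<mu> k)" for D
  define num where "num = \<P>(w in M. R (T w) \<and> card (T w) = n)"
  define den where "den = \<P>(w in M. card (T w) = n)"
  let ?\<D> = "degs ` {t. size (degs t) = n}"
  have f0: "f D \<ge> 0" for D unfolding f_def by (induction D) auto
  have n0: "n > 0" using assms(2) by simp
  have num: "num = (\<Sum>D\<in>?\<D>. f D * real (card {t \<in> trees_with D. R (verts t)}))"
    unfolding num_def f_def prob_bienayme_tree_size[OF assms(1) n0] by (rule sum_trees_group)
  have den: "den = (\<Sum>D\<in>?\<D>. f D * real (card (trees_with D)))"
    using prob_bienayme_tree_size[OF assms(1) n0, of "\<lambda>_. True"] sum_trees_group[where R = "\<lambda>_. True" and f = f and n = n]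
    by (simp add: den_def f_def)
  have "num / den \<le> 230 * s powr (- 2 / 13)"
  \<comment> \<open>Up to \<open>10 ^ 13\<close> the power \<open>s powr (2 / 13)\<close> is at most
    100, so the claimed bound is above 1.\<close>
  proof (cases "s \<le> 10 ^ 13")
    case True
    have "num \<le> den"
      unfolding num den by (intro sum_mono mult_left_mono of_nat_mono card_mono) (auto simp: f0 finite_trees)
    then have "num / den \<le> 1" using assms(3) by (simp add: den_def)
    moreover have "s powr (2 / 13) \<le> 230"
    proof -
      have "s powr (2 / 13) \<le> (10 ^ 13) powr (2 / 13)" using True assms(4) by (intro powr_mono2) auto
      also have "(10 ^ 13 :: real) = 10 powr 13" by (simp add: powr_numeral)
      also have "(10 powr 13) powr (2 / 13) = (10 :: real) powr 2" by (simp add: powr_powr)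
      finally show ?thesis by (simp add: powr_numeral)
    qed
    then have "1 \<le> 230 * s powr (- 2 / 13)"
      using assms(4) by (simp add: powr_minus_divide field_simps)
    ultimately show ?thesis by linarith
  next
    case False
    then have s: "s \<ge> 10 ^ 6" "s \<ge> 1" by auto
    \<comment> \<open>The bound holds for each \<open>D\<close> separately, hence for the mixture
      over \<open>D\<close> with weights \<open>f D\<close>.\<close>
    have "num \<le> (\<Sum>D\<in>?\<D>. f D * (4 / s * real (card (trees_with D))))"
      unfolding num
    proof (intro sum_mono mult_left_mono f0)
      fix D assume "D \<in> ?\<D>"
      then have D: "sum_mset D + 1 = size D" "size D = n" using degs_sum_size by auto
      show "real (card {t \<in> trees_with D. R (verts t)}) \<le> 4 / s * real (card (trees_with D))"
        unfolding R_def using card_wide_high_trees_le[OF D(1) _ s(1)] D(2) assms(2) by simp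
    qed
    also have "\<dots> = 4 / s * den" unfolding den sum_distrib_left by (simp add: mult_ac)
    finally have "num / den \<le> 4 / s" using assms(3) by (simp add: den_def field_simps)
    also have "\<dots> \<le> 230 * s powr (- 1)" using s by (simp add: powr_minus_divide field_simps)
    also have "\<dots> \<le> 230 * s powr (- 2 / 13)" using s by (intro mult_left_mono powr_mono) auto
    finally show ?thesis .
  qed
  then show ?thesis by (simp add: cond_prob_def num_def den_def R_def)
qed

end
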